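(* Let $\mu>0$, $\tau_s\ge0$, $\varepsilon>0$, $\mathbf f\in\mathbf H^{-1}(\Omega)$. Let $(\mathbf u,p)\in\mathbf X\times Q$ be the solution pair of the regularized Bingham problem $$2\mu(D\mathbf u,D\mathbf v)+\tau_s\Big(\frac{D\mathbf u}{|D\mathbf u|_\varepsilon},D\mathbf v\Big)-(p,\nabla\cdot\mathbf v)=(\mathbf f,\mathbf v),\qquad (q,\nabla\cdot\mathbf u)=0\qquad\forall(\mathbf v,q)\in\mathbf X\times Q,$$ and let $\mathbf u_h\in\mathbf V_h$ be the solution of $$2\mu(D\mathbf u_h,D\mathbf v_h)+\tau_s\Big(\frac{D\mathbf u_h}{|D\mathbf u_h|_\varepsilon},D\mathbf v_h\Big)=(\mathbf f,\mathbf v_h)\qquad\forall\mathbf v_h\in\mathbf V_h.$$ Let $I_h(\mathbf u)\in\mathbf V_h$ be the interpolant of $\mathbf u$. Then $$\|D(\mathbf u-\mathbf u_h)\|\le\mu^{-1}\sqrt d\inf_{q_h\in Q_h}\|p-q_h\|+\big(3+3\tau_s^2\varepsilon^{-2}\mu^{-2}\big)^{1/2}\|D(\mathbf u-I_h(\mathbf u))\|.$$ Furthermore, if $h$ is small enough so that $\big\||D\mathbf u|_\varepsilon^{-1}D(I_h(\mathbf u)-\mathbf u_h)\big\|\le1$, then also $$\|D(\mathbf u-\mathbf u_h)\|\le\mu^{-1}\sqrt d\inf_{q_h\in Q_h}\|p-q_h\|+\sqrt2\,\|D(\mathbf u-I_h(\mathbf u))\|+(2\mu^{-1}\tau_s)^{1/2}\|D(\mathbf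 u-I_h(\mathbf u))\|^{1/2}.$$
   Context: $\Omega\subset\mathbb R^d$, $d\in\{2,3\}$, is a bounded connected polygonal/polyhedral (or Lipschitz) domain; $\|\cdot\|$, $(\cdot,\cdot)$ are the $L^2(\Omega)$ norm and inner product (or duality pairing for $\mathbf f$). $D\mathbf v=\frac12(\nabla\mathbf v+\nabla\mathbf v^T)$ and $|D\mathbf v|_\varepsilon=\sqrt{D\mathbf v:D\mathbf v+\varepsilon^2}$. $\mathbf X=H_0^1(\Omega)^d$, $Q=L_0^2(\Omega)$ (mean-zero $L^2$ functions). On a regular conforming triangulation $\tau_h$ of $\Omega$ with maximum element diameter $h$, $\mathbf X_h=\mathbf X\cap P_s(\tau_h)$ and $Q_h=Q\cap P_r(\tau_h)$ are piecewise polynomial finite element spaces satisfying the discrete inf-sup (LBB) condition with constant independent of $h$, and $\mathbf V_h=\{\mathbf v_h\in\mathbf X_h:(\nabla\cdot\mathbf v_h,q_h)=0\ \forall q_h\in Q_h\}$. $I_h$ is an interpolation operator with values in $\mathbf V_h$ satisfying, for divergence-free $\mathbf v\in\mathbf X$ of the required smoothness, $\|\mathbf v-I_h(\mathbf v)\|\le Ch^{s+1}|\mathbf v|_{s+1}$ and $\|\nabla(\mathbf v-I_h(\mathbf v))\|\le Ch^s|\mathbf v|_{s+1}$. Both the continuous and discrete problems have unique solutions. *)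

theory Defs
  imports "HOL-Analysis.Analysis"
begin

section \<open>Square-integrable functions\<close>

text \<open>
  Elements of the Lebesgue and Sobolev spaces are represented by functions on the whole space, of
  which only the values almost everywhere in \<open>\<Omega>\<close> matter. For matrix-valued functions the inner
  product and norm of the type \<open>real^'n^'n\<close> are the Frobenius product \<open>A : B\<close> and norm.
\<close>

definition L2 :: "(real^'n) set \<Rightarrow> (real^'n \<Rightarrow> 'b::euclidean_space) set" where
  "L2 \<Omega> = {f \<in> borel_measurable (lebesgue_on \<Omega>). integrable (lebesgue_on \<Omega>) (\<lambda>x. (norm (f x))\<^sup>2)}"

definition l2_inner :: "(real^'n) set \<Rightarrow> (real^'n \<Rightarrow> 'b::euclidean_space) \<Rightarrow> (real^'n \<Rightarrow> 'b) \<Rightarrow> real" where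
  "l2_inner \<Omega> f g = (\<integral>x. f x \<bullet> g x \<partial>lebesgue_on \<Omega>)"

definition l2_norm :: "(real^'n) set \<Rightarrow> (real^'n \<Rightarrow> 'b::euclidean_space) \<Rightarrow> real" where
  "l2_norm \<Omega> f = sqrt (\<integral>x. (norm (f x))\<^sup>2 \<partial>lebesgue_on \<Omega>)"

definition L2_zero_mean :: "(real^'n) set \<Rightarrow> (real^'n \<Rightarrow> real) set" where
  "L2_zero_mean \<Omega> = {q \<in> L2 \<Omega>. (\<integral>x. q x \<partial>lebesgue_on \<Omega>) = 0}"

section \<open>Weak derivatives and Sobolev spaces\<close>

definition partial :: "'n \<Rightarrow> (real^'n \<Rightarrow> real) \<Rightarrow> (real^'n \<Rightarrow> real)" where
  "partial j \<phi> = (\<lambda>x. frechet_derivative \<phi> (at x) (axis j 1))"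

text \<open>The list \<open>[j\<^sub>1, \<dots>, j\<^sub>k]\<close> stands for the derivative of order \<open>k\<close> in the coordinate directions
  \<open>j\<^sub>1, \<dots>, j\<^sub>k\<close>.\<close>

definition partials :: "'n list \<Rightarrow> (real^'n \<Rightarrow> real) \<Rightarrow> (real^'n \<Rightarrow> real)" where
  "partials js \<phi> = foldr partial js \<phi>"

definition test_functions :: "(real^'n) set \<Rightarrow> (real^'n \<Rightarrow> real) set" where
  "test_functions \<Omega> = {\<phi>. (\<forall>js x. partials js \<phi> differentiable (at x)) \<and>
     compact (closure {x. \<phi> x \<noteq> 0}) \<and> closure {x. \<phi> x \<noteq> 0} \<subseteq> \<Omega>}"

definition has_weak_partials ::
    "(real^'n) set \<Rightarrow> 'n list \<Rightarrow> (real^'n \<Rightarrow> real) \<Rightarrow> (real^'n \<Rightarrow> real) \<Rightarrow> bool" where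
  "has_weak_partials \<Omega> js f g \<longleftrightarrow> f \<in> L2 \<Omega> \<and> g \<in> L2 \<Omega> \<and>
     (\<forall>\<phi>\<in>test_functions \<Omega>.
        (\<integral>x. f x * partials js \<phi> x \<partial>lebesgue_on \<Omega>) =
        (-1) ^ length js * (\<integral>x. g x * \<phi> x \<partial>lebesgue_on \<Omega>))"

text \<open>On an open set weak derivatives are unique almost everywhere; the choice picks a representative.\<close>

definition weak_partials :: "(real^'n) set \<Rightarrow> 'n list \<Rightarrow> (real^'n \<Rightarrow> real) \<Rightarrow> (real^'n \<Rightarrow> real)" where
  "weak_partials \<Omega> js f = (SOME g. has_weak_partials \<Omega> js f g)"

definition sobolev :: "(real^'n) set \<Rightarrow> nat \<Rightarrow> (real^'n \<Rightarrow> real) set" where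
  "sobolev \<Omega> k = {f. \<forall>js. length js \<le> k \<longrightarrow> (\<exists>g. has_weak_partials \<Omega> js f g)}"

text \<open>\<open>H\<^sub>0\<^sup>1(\<Omega>)\<close>: the closure of the test functions in \<open>H\<^sup>1(\<Omega>)\<close>.\<close>

definition sobolev_zero :: "(real^'n) set \<Rightarrow> (real^'n \<Rightarrow> real) set" where
  "sobolev_zero \<Omega> = {f \<in> sobolev \<Omega> 1. \<exists>\<phi> :: nat \<Rightarrow> real^'n \<Rightarrow> real.
     (\<forall>n. \<phi> n \<in> test_functions \<Omega>) \<and>
     (\<lambda>n. l2_norm \<Omega> (\<lambda>x. f x - \<phi> n x)) \<longlonglongrightarrow> 0 \<and>
     (\<forall>j. (\<lambda>n. l2_norm \<Omega> (\<lambda>x. weak_partials \<Omega> [j] f x - partial j (\<phi> n) x)) \<longlonglongrightarrow> 0)}"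

definition vec_sobolev :: "(real^'n) set \<Rightarrow> nat \<Rightarrow> (real^'n \<Rightarrow> real^'n) set" where
  "vec_sobolev \<Omega> k = {v. \<forall>i. (\<lambda>x. v x $ i) \<in> sobolev \<Omega> k}"

definition velocity_space :: "(real^'n) set \<Rightarrow> (real^'n \<Rightarrow> real^'n) set" where
  "velocity_space \<Omega> = {v. \<forall>i. (\<lambda>x. v x $ i) \<in> sobolev_zero \<Omega>}"

text \<open>The seminorm \<open>|v|\<^sub>k\<close>: the \<open>L\<^sup>2\<close> norm of the full tensor of weak derivatives of order \<open>k\<close>.\<close>

definition sobolev_seminorm :: "(real^'n) set \<Rightarrow> nat \<Rightarrow> (real^'n \<Rightarrow> real^'n) \<Rightarrow> real" where
  "sobolev_seminorm \<Omega> k v =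
     sqrt (\<Sum>i\<in>UNIV. \<Sum>js | length js = k. (l2_norm \<Omega> (weak_partials \<Omega> js (\<lambda>x. v x $ i)))\<^sup>2)"

definition wgrad :: "(real^'n) set \<Rightarrow> (real^'n \<Rightarrow> real^'n) \<Rightarrow> real^'n \<Rightarrow> real^'n^'n" where
  "wgrad \<Omega> v x = (\<chi> i j. weak_partials \<Omega> [j] (\<lambda>y. v y $ i) x)"

definition wdiv :: "(real^'n) set \<Rightarrow> (real^'n \<Rightarrow> real^'n) \<Rightarrow> real^'n \<Rightarrow> real" where
  "wdiv \<Omega> v x = (\<Sum>i\<in>UNIV. wgrad \<Omega> v x $ i $ i)"

definition strain :: "(real^'n) set \<Rightarrow> (real^'n \<Rightarrow> real^'n) \<Rightarrow> real^'n \<Rightarrow> real^'n^'n" where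
  "strain \<Omega> v x = (1/2) *\<^sub>R (wgrad \<Omega> v x + transpose (wgrad \<Omega> v x))"

definition reg_norm :: "real \<Rightarrow> real^'n^'n \<Rightarrow> real" where
  "reg_norm \<epsilon> A = sqrt (A \<bullet> A + \<epsilon>\<^sup>2)"

text \<open>\<open>H\<^sup>-\<^sup>1(\<Omega>)\<^sup>d\<close>: the bounded linear functionals on \<open>H\<^sub>0\<^sup>1(\<Omega>)\<^sup>d\<close>; the pairing \<open>(f, v)\<close> is application.\<close>

definition dual_velocity_space :: "(real^'n) set \<Rightarrow> ((real^'n \<Rightarrow> real^'n) \<Rightarrow> real) set" where
  "dual_velocity_space \<Omega> = {f.
     (\<forall>v\<in>velocity_space \<Omega>. \<forall>w\<in>velocity_space \<Omega>. \<forall>a b.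
        f (\<lambda>x. a *\<^sub>R v x + b *\<^sub>R w x) = a * f v + b * f w) \<and>
     (\<exists>C. \<forall>v\<in>velocity_space \<Omega>.
        \<bar>f v\<bar> \<le> C * sqrt ((l2_norm \<Omega> v)\<^sup>2 + (l2_norm \<Omega> (wgrad \<Omega> v))\<^sup>2))}"

section \<open>Domains and meshes\<close>

definition polyhedral_domain :: "(real^'n) set \<Rightarrow> bool" where
  "polyhedral_domain \<Omega> \<longleftrightarrow> interior (closure \<Omega>) = \<Omega> \<and>
     (\<exists>P. finite P \<and> (\<forall>S\<in>P. polytope S) \<and> closure \<Omega> = \<Union>P)"

text \<open>Near each boundary point, \<open>\<Omega>\<close> is the part above the graph of a Lipschitz function \<open>g\<close> over the
  hyperplane orthogonal to some unit vector \<open>e\<close>.\<close>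

definition lipschitz_domain :: "(real^'n) set \<Rightarrow> bool" where
  "lipschitz_domain \<Omega> \<longleftrightarrow> open \<Omega> \<and> (\<forall>x\<in>frontier \<Omega>. \<exists>e L g U. norm e = 1 \<and>
     L-lipschitz_on {y. y \<bullet> e = 0} g \<and> open U \<and> x \<in> U \<and>
     (\<forall>y\<in>U. y \<in> \<Omega> \<longleftrightarrow> y \<bullet> e > g (y - (y \<bullet> e) *\<^sub>R e)))"

definition admissible_domain :: "(real^'n) set \<Rightarrow> bool" where
  "admissible_domain \<Omega> \<longleftrightarrow> \<Omega> \<noteq> {} \<and> open \<Omega> \<and> bounded \<Omega> \<and> connected \<Omega> \<and>
     (polyhedral_domain \<Omega> \<or> lipschitz_domain \<Omega>)"

definition conforming_mesh :: "(real^'n) set \<Rightarrow> (real^'n) set set \<Rightarrow> bool" where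
  "conforming_mesh \<Omega> T \<longleftrightarrow>
     triangulation T \<and> (\<forall>K\<in>T. int CARD('n) simplex K) \<and> \<Union>T = closure \<Omega>"

definition inradius :: "(real^'n) set \<Rightarrow> real" where
  "inradius K = Sup {r. 0 \<le> r \<and> (\<exists>x. cball x r \<subseteq> K)}"

text \<open>A family of meshes indexed by their sizes \<open>h \<in> H\<close>; the shape-regularity constant is uniform
  over the family.\<close>

definition regular_mesh_family ::
    "(real^'n) set \<Rightarrow> real set \<Rightarrow> (real \<Rightarrow> (real^'n) set set) \<Rightarrow> bool" where
  "regular_mesh_family \<Omega> H \<T> \<longleftrightarrow>
     (\<forall>h\<in>H. conforming_mesh \<Omega> (\<T> h) \<and> h = Max (diameter ` \<T> h)) \<and>
     (\<exists>\<sigma>>0. \<forall>h\<in>H. \<forall>K\<in>\<T> h. diameter K \<le> \<sigma> * inradius K)"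

section \<open>Finite element spaces\<close>

text \<open>Polynomials of total degree at most \<open>k\<close>.\<close>

definition polynomials_upto :: "nat \<Rightarrow> (real^'n \<Rightarrow> real) set" where
  "polynomials_upto k = {p. \<exists>c :: ('n \<Rightarrow> nat) \<Rightarrow> real.
     p = (\<lambda>x. \<Sum>\<alpha> | (\<Sum>i\<in>UNIV. \<alpha> i) \<le> k. c \<alpha> * (\<Prod>i\<in>UNIV. x $ i ^ \<alpha> i))}"

text \<open>No continuity across the element interfaces is imposed here; for velocities it comes from the
  intersection with \<open>H\<^sub>0\<^sup>1\<close>.\<close>

definition piecewise_polynomials :: "(real^'n) set set \<Rightarrow> nat \<Rightarrow> (real^'n \<Rightarrow> real) set" where
  "piecewise_polynomials T k =
     {f. \<forall>K\<in>T. \<exists>p\<in>polynomials_upto k. AE x in lebesgue_on K. f x = p x}"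

definition fe_velocity :: "(real^'n) set \<Rightarrow> (real^'n) set set \<Rightarrow> nat \<Rightarrow> (real^'n \<Rightarrow> real^'n) set" where
  "fe_velocity \<Omega> T s =
     velocity_space \<Omega> \<inter> {v. \<forall>i. (\<lambda>x. v x $ i) \<in> piecewise_polynomials T s}"

definition fe_pressure :: "(real^'n) set \<Rightarrow> (real^'n) set set \<Rightarrow> nat \<Rightarrow> (real^'n \<Rightarrow> real) set" where
  "fe_pressure \<Omega> T r = L2_zero_mean \<Omega> \<inter> piecewise_polynomials T r"

definition fe_div_free ::
    "(real^'n) set \<Rightarrow> (real^'n) set set \<Rightarrow> nat \<Rightarrow> nat \<Rightarrow> (real^'n \<Rightarrow> real^'n) set" where
  "fe_div_free \<Omega> T s r =
     {v \<in> fe_velocity \<Omega> T s. \<forall>q\<in>fe_pressure \<Omega> T r. l2_inner \<Omega> (wdiv \<Omega> v) q = 0}"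

text \<open>The infimum and the supremum are taken in the extended reals, where those of the empty set are
  \<open>\<infinity>\<close> and \<open>-\<infinity>\<close>.\<close>

definition discrete_inf_sup ::
    "(real^'n) set \<Rightarrow> real set \<Rightarrow> (real \<Rightarrow> (real^'n) set set) \<Rightarrow> nat \<Rightarrow> nat \<Rightarrow> bool" where
  "discrete_inf_sup \<Omega> H \<T> s r \<longleftrightarrow> (\<exists>\<beta>>0. \<forall>h\<in>H.
     ereal \<beta> \<le>
       (INF q\<in>{q \<in> fe_pressure \<Omega> (\<T> h) r. l2_norm \<Omega> q \<noteq> 0}.
        SUP v\<in>{v \<in> fe_velocity \<Omega> (\<T> h) s. l2_norm \<Omega> (wgrad \<Omega> v) \<noteq> 0}.
          ereal (l2_inner \<Omega> q (wdiv \<Omega> v) / (l2_norm \<Omega> (wgrad \<Omega> v) * l2_norm \<Omega> q))))"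

definition interpolation_operators ::
    "(real^'n) set \<Rightarrow> real set \<Rightarrow> (real \<Rightarrow> (real^'n) set set) \<Rightarrow> nat \<Rightarrow> nat \<Rightarrow>
     (real \<Rightarrow> (real^'n \<Rightarrow> real^'n) \<Rightarrow> (real^'n \<Rightarrow> real^'n)) \<Rightarrow> bool" where
  "interpolation_operators \<Omega> H \<T> s r I \<longleftrightarrow> (\<exists>C. \<forall>h\<in>H.
     \<forall>v \<in> velocity_space \<Omega> \<inter> vec_sobolev \<Omega> (s + 1).
       (AE x in lebesgue_on \<Omega>. wdiv \<Omega> v x = 0) \<longrightarrow>
         I h v \<in> fe_div_free \<Omega> (\<T> h) s r \<and>
         l2_norm \<Omega> (\<lambda>x. v x - I h v x) \<le> C * h ^ (s + 1) * sobolev_seminorm \<Omega> (s + 1) v \<and>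
         l2_norm \<Omega> (wgrad \<Omega> (\<lambda>x. v x - I h v x)) \<le> C * h ^ s * sobolev_seminorm \<Omega> (s + 1) v)"

section \<open>The regularized Bingham problem\<close>

definition bingham_form ::
    "(real^'n) set \<Rightarrow> real \<Rightarrow> real \<Rightarrow> real \<Rightarrow> (real^'n \<Rightarrow> real^'n) \<Rightarrow> (real^'n \<Rightarrow> real^'n) \<Rightarrow> real" where
  "bingham_form \<Omega> \<mu> \<tau> \<epsilon> u v =
     2 * \<mu> * l2_inner \<Omega> (strain \<Omega> u) (strain \<Omega> v) +
     \<tau> * l2_inner \<Omega> (\<lambda>x. strain \<Omega> u x /\<^sub>R reg_norm \<epsilon> (strain \<Omega> u x)) (strain \<Omega> v)"

definition bingham_solution ::
    "(real^'n) set \<Rightarrow> real \<Rightarrow> real \<Rightarrow> real \<Rightarrow> ((real^'n \<Rightarrow> real^'n) \<Rightarrow> real) \<Rightarrow>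
     (real^'n \<Rightarrow> real^'n) \<Rightarrow> (real^'n \<Rightarrow> real) \<Rightarrow> bool" where
  "bingham_solution \<Omega> \<mu> \<tau> \<epsilon> f u p \<longleftrightarrow>
     u \<in> velocity_space \<Omega> \<and> p \<in> L2_zero_mean \<Omega> \<and>
     (\<forall>v\<in>velocity_space \<Omega>. \<forall>q\<in>L2_zero_mean \<Omega>.
        bingham_form \<Omega> \<mu> \<tau> \<epsilon> u v - l2_inner \<Omega> p (wdiv \<Omega> v) = f v \<and>
        l2_inner \<Omega> q (wdiv \<Omega> u) = 0)"

definition discrete_bingham_solution ::
    "(real^'n) set \<Rightarrow> (real^'n) set set \<Rightarrow> nat \<Rightarrow> nat \<Rightarrow> real \<Rightarrow> real \<Rightarrow> real \<Rightarrow>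
     ((real^'n \<Rightarrow> real^'n) \<Rightarrow> real) \<Rightarrow> (real^'n \<Rightarrow> real^'n) \<Rightarrow> bool" where
  "discrete_bingham_solution \<Omega> T s r \<mu> \<tau> \<epsilon> f u\<^sub>h \<longleftrightarrow>
     u\<^sub>h \<in> fe_div_free \<Omega> T s r \<and>
     (\<forall>v\<in>fe_div_free \<Omega> T s r. bingham_form \<Omega> \<mu> \<tau> \<epsilon> u\<^sub>h v = f v)"

end

theory Submission
  imports Defs "HOL-Computational_Algebra.Polynomial"
begin

text \<open>
  Write \<open>F A = A / |A|\<^sub>\<epsilon>\<close>, \<open>e = u - u\<^sub>h\<close>, \<open>\<eta> = u - I\<^sub>h u\<close>, \<open>\<phi> = I\<^sub>h u - u\<^sub>h\<close>. Testing both problems with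
  \<open>\<phi>\<close> gives \<open>2\<mu> (De, D\<phi>) + \<tau> (F(Du) - F(Du\<^sub>h), D\<phi>) = (p - q, div \<phi>)\<close> for every discrete pressure \<open>q\<close>.
  Since \<open>\<phi> = e - \<eta>\<close> and \<open>F\<close> is monotone and Lipschitz with constant \<open>1/\<epsilon>\<close>, the numbers
  \<open>E = \<parallel>De\<parallel>\<close>, \<open>H = \<parallel>D\<eta>\<parallel>\<close>, \<open>c = \<surd>d \<parallel>p - q\<parallel> / (2\<mu>)\<close> satisfy \<open>E\<^sup>2 \<le> k E H + c (E + H)\<close> with
  \<open>k = 1 + \<tau>/(2\<epsilon>\<mu>)\<close>, which forces \<open>E \<le> 2c + k H\<close>, and \<open>k\<^sup>2 \<le> 3 + 3\<tau>\<^sup>2/(\<epsilon>\<mu>)\<^sup>2\<close>. For the second bound one compares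
  \<open>F(Du)\<close> with \<open>F(D I\<^sub>h u)\<close> instead and uses \<open>|F A - F B| \<le> 2 |A - B| / |A|\<^sub>\<epsilon>\<close>.

  That \<open>D(v - w) = Dv - Dw\<close> almost everywhere rests on the uniqueness of weak derivatives: a function
  orthogonal to all test functions has integral zero over every box, because indicators of boxes are
  bounded limits of products of one-dimensional bumps built from \<open>exp(-1/t)\<close>.
\<close>

section \<open>Test functions and the fundamental lemma of the calculus of variations\<close>

definition flat :: "real poly \<Rightarrow> real \<Rightarrow> real" where
  "flat p t = (if t > 0 then poly p (inverse t) * exp (- inverse t) else 0)"

lemma poly_times_exp_minus_tendsto_0: "((\<lambda>y::real. poly p y * exp (- y)) \<longlongrightarrow> 0) at_top"
proof -
  have "((\<lambda>y::real. \<Sum>i\<le>degree p. coeff p i * (y ^ i / exp y)) \<longlongrightarrow> (\<Sum>i\<le>degree p. coeff p i * 0)) at_top"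
    by (intro tendsto_intros tendsto_power_div_exp_0)
  then show ?thesis
    by (simp add: poly_altdef exp_minus sum_distrib_right divide_inverse mult.assoc)
qed

text \<open>With \<open>y = 1/t\<close>, differentiating \<open>p(y) * exp(-y)\<close> in
  \<open>t\<close> gives \<open>y^2 * (p(y) - p'(y)) * exp(-y)\<close>: the polynomial parameter
  makes the family closed under differentiation, so this one formula covers derivatives of every
  order. At 0 the exponential decay beats the polynomial.\<close>

lemma has_real_derivative_flat:
  "(flat p has_real_derivative flat (monom 1 2 * (p - pderiv p)) t) (at t)"
proof -
  consider "t > 0" | "t < 0" | "t = 0" by linarith
  then show ?thesis
  proof cases
    case 1
    have "((\<lambda>t. poly p (inverse t) * exp (- inverse t)) has_real_derivative
        flat (monom 1 2 * (p - pderiv p)) t) (at t)"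
      using 1 by (auto intro!: derivative_eq_intros DERIV_chain'[OF _ poly_DERIV]
          simp: flat_def poly_monom field_simps power2_eq_square)
    then show ?thesis
      by (rule has_field_derivative_transform_within[where d = t]) (use 1 in \<open>auto simp: flat_def dist_real_def\<close>)
  next
    case 2
    have "((\<lambda>t. 0) has_real_derivative flat (monom 1 2 * (p - pderiv p)) t) (at t)"
      using 2 by (simp add: flat_def)
    then show ?thesis
      by (rule has_field_derivative_transform_within[where d = "- t"]) (use 2 in \<open>auto simp: flat_def dist_real_def\<close>)
  next
    case 3
    have "((\<lambda>y. flat p y / y) \<longlongrightarrow> 0) (at_left 0)"
      by (rule tendsto_eventually) (auto simp: eventually_at_filter flat_def)
    moreover have "((\<lambda>y. flat p y / y) \<longlongrightarrow> 0) (at_right 0)"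
    proof -
      \<comment> \<open>\<open>pCons 0 p\<close> is \<open>X * p\<close>; the extra factor
        \<open>1/y\<close> is the division in the difference quotient.\<close>
      have "((\<lambda>y. poly (pCons 0 p) (inverse y) * exp (- inverse y)) \<longlongrightarrow> 0) (at_right 0)"
        by (rule filterlim_compose[OF poly_times_exp_minus_tendsto_0 filterlim_inverse_at_top_right])
      then show ?thesis
        by (rule Lim_transform_eventually)
          (auto simp: eventually_at_filter flat_def field_simps intro!: always_eventually)
    qed
    ultimately have "((\<lambda>y. flat p y / y) \<longlongrightarrow> 0) (at 0)"
      by (rule filterlim_split_at)
    then show ?thesis
      using 3 by (simp add: has_field_derivative_iff flat_def)
  qed
qed

text \<open>A class closed under \<open>partial\<close> whose members are all differentiable.
  Smoothness of a concrete bump then reduces to membership, with no computation of higher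
  derivatives.\<close>

inductive_set bump_algebra :: "(real^'n \<Rightarrow> real) set" where
  const: "(\<lambda>x. c) \<in> bump_algebra"
| flat: "(\<lambda>x. flat p (c * x $ i + d)) \<in> bump_algebra"
| add: "\<lbrakk>f \<in> bump_algebra; g \<in> bump_algebra\<rbrakk> \<Longrightarrow> (\<lambda>x. f x + g x) \<in> bump_algebra"
| mult: "\<lbrakk>f \<in> bump_algebra; g \<in> bump_algebra\<rbrakk> \<Longrightarrow> (\<lambda>x. f x * g x) \<in> bump_algebra"

lemma partial_eqI: "(f has_derivative D) (at x) \<Longrightarrow> partial j f x = D (axis j 1)"
  unfolding partial_def using frechet_derivative_at by metis

text \<open>Both claims go through one induction: in the sum and product cases the differentiability
  of the parts is what identifies \<open>partial\<close> with the value given by the usual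
  rules.\<close>

lemma bump_algebra_differentiable_partial:
  assumes "f \<in> bump_algebra"
  shows "(\<forall>x. f differentiable (at x)) \<and> partial j f \<in> bump_algebra"
  using assms
proof induction
  case (const c)
  have "partial j (\<lambda>x. c) = (\<lambda>x. 0)"
    by (simp add: partial_def)
  then show ?case
    by (simp add: bump_algebra.const)
next
  case (flat p c i d)
  let ?q = "monom 1 2 * (p - pderiv p)"
  have D: "((\<lambda>x. flat p (c * x $ i + d)) has_derivative
      (\<lambda>v. c * v $ i * flat ?q (c * x $ i + d))) (at x)" for x
  proof -
    have "((\<lambda>x. c * x $ i + d) has_derivative (\<lambda>v. c * v $ i)) (at x)"
      by (auto intro!: derivative_eq_intros bounded_linear_imp_has_derivative bounded_linear_vec_nth)
    from has_derivative_compose[OF this has_real_derivative_flat[unfolded has_field_derivative_def]]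
    show ?thesis by (simp add: mult.commute)
  qed
  have "partial j (\<lambda>x. flat p (c * x $ i + d)) =
      (\<lambda>x. (c * axis j 1 $ i) * flat ?q (c * x $ i + d))"
    using partial_eqI[OF D] by auto
  then show ?case
    using D by (auto simp: differentiable_def intro!: bump_algebra.intros)
next
  case (add f g)
  then have "(f has_derivative frechet_derivative f (at x)) (at x)"
    "(g has_derivative frechet_derivative g (at x)) (at x)" for x
    using frechet_derivative_works by blast+
  from partial_eqI[OF has_derivative_add[OF this]]
  have "partial j (\<lambda>x. f x + g x) = (\<lambda>x. partial j f x + partial j g x)"
    by (auto simp: partial_def)
  then show ?case
    using add by (auto intro: bump_algebra.intros)
next
  case (mult f g)
  then have "(f has_derivative frechet_derivative f (at x)) (at x)"
    "(g has_derivative frechet_derivative g (at x)) (at x)" for x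
    using frechet_derivative_works by blast+
  from partial_eqI[OF has_derivative_mult[OF this]]
  have "partial j (\<lambda>x. f x * g x) = (\<lambda>x. f x * partial j g x + partial j f x * g x)"
    by (auto simp: partial_def)
  then show ?case
    using mult by (auto intro!: bump_algebra.intros)
qed

lemma partials_Cons [simp]: "partials (j # js) \<phi> = partial j (partials js \<phi>)"
  by (simp add: partials_def)

lemma partials_Nil [simp]: "partials [] \<phi> = \<phi>"
  by (simp add: partials_def)

lemma bump_algebra_partials: "f \<in> bump_algebra \<Longrightarrow> partials js f \<in> bump_algebra"
  by (induction js) (auto simp: bump_algebra_differentiable_partial)

lemma bump_algebra_prod:
  assumes "finite A" "\<And>i. i \<in> A \<Longrightarrow> f i \<in> bump_algebra"
  shows "(\<lambda>x. \<Prod>i\<in>A. f i x) \<in> bump_algebra"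
  using assms
proof (induction A rule: finite_induct)
  case empty
  then show ?case by (simp add: bump_algebra.const)
next
  case (insert i A)
  then have "(\<lambda>x. f i x * (\<Prod>i\<in>A. f i x)) \<in> bump_algebra"
    by (intro bump_algebra.mult) auto
  then show ?case using insert by simp
qed

section \<open>Smooth bumps exhausting a box\<close>

definition box_bump :: "real^'n \<Rightarrow> real^'n \<Rightarrow> nat \<Rightarrow> real^'n \<Rightarrow> real" where
  "box_bump a b k x = (\<Prod>i\<in>UNIV. flat 1 (real (Suc k) * (x $ i - a $ i)) * flat 1 (real (Suc k) * (b $ i - x $ i)))"

lemma flat_1_bounds: "0 \<le> flat 1 t" "flat 1 t \<le> 1"
  by (auto simp: flat_def)

lemma flat_1_eq_0_iff: "flat 1 t = 0 \<longleftrightarrow> t \<le> 0"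
  by (auto simp: flat_def)

lemma box_bump_bounds: "0 \<le> box_bump a b k x" "box_bump a b k x \<le> 1"
  unfolding box_bump_def
  by (auto intro!: prod_nonneg prod_le_1 mult_nonneg_nonneg mult_le_one simp: flat_1_bounds)

lemma box_bump_eq_0_iff: "box_bump a b k x = 0 \<longleftrightarrow> x \<notin> box a b"
  by (auto simp: box_bump_def flat_1_eq_0_iff mem_box_cart mult_le_0_iff not_less)

text \<open>Inside the box every argument of \<open>flat 1\<close> is a positive number times
  \<open>Suc k\<close>, so each factor \<open>exp (-1/t)\<close> tends to 1; outside, some factor is
  0 for every \<open>k\<close>. Scaling by \<open>Suc k\<close> rather than \<open>k\<close> keeps
  the bump positive on the box already at \<open>k = 0\<close>.\<close>

lemma box_bump_tendsto: "(\<lambda>k. box_bump a b k x) \<longlonglongrightarrow> indicator (box a b) x"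
proof (cases "x \<in> box a b")
  case True
  have *: "(\<lambda>k. flat 1 (real (Suc k) * t)) \<longlonglongrightarrow> 1" if "t > 0" for t
  proof -
    have "(\<lambda>k. exp (- (inverse (real (Suc k)) * inverse t))) \<longlonglongrightarrow> exp (- (0 * inverse t))"
      by (intro tendsto_intros LIMSEQ_inverse_real_of_nat)
    then show ?thesis
      using that by (simp add: flat_def)
  qed
  have "(\<lambda>k. box_bump a b k x) \<longlonglongrightarrow> (\<Prod>i\<in>(UNIV::'a set). 1 * 1)"
    unfolding box_bump_def
    by (intro tendsto_intros *) (use True in \<open>auto simp: mem_box_cart\<close>)
  then show ?thesis
    using True by simp
next
  case False
  then have "box_bump a b k x = 0" for k
    by (simp add: box_bump_eq_0_iff)
  then show ?thesis
    using False by simp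
qed

lemma box_bump_test_function:
  assumes "cbox a b \<subseteq> \<Omega>"
  shows "box_bump a b k \<in> test_functions \<Omega>"
proof -
  have f: "(\<lambda>x::real^'n. flat 1 (real (Suc k) * (x $ i - a $ i))) \<in> bump_algebra" for i and a :: "real^'n"
    using bump_algebra.flat[of 1 "real (Suc k)" i "- real (Suc k) * a $ i"]
    by (simp add: algebra_simps)
  have g: "(\<lambda>x::real^'n. flat 1 (real (Suc k) * (b $ i - x $ i))) \<in> bump_algebra" for i and b :: "real^'n"
    using bump_algebra.flat[of 1 "- real (Suc k)" i "real (Suc k) * b $ i"]
    by (simp add: algebra_simps)
  have "box_bump a b k \<in> bump_algebra"
    unfolding box_bump_def by (intro bump_algebra_prod bump_algebra.mult f g) auto
  moreover have "closure {x. box_bump a b k x \<noteq> 0} \<subseteq> cbox a b"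
    by (intro closure_minimal) (use box_subset_cbox[of a b] in \<open>auto simp: box_bump_eq_0_iff\<close>)
  moreover have "partials js (box_bump a b k) differentiable (at x)" for js x
    using bump_algebra_differentiable_partial[OF bump_algebra_partials] calculation(1) by blast
  ultimately show ?thesis
    using assms compact_Int_closed[OF compact_cbox closed_closure, of a b "{x. box_bump a b k x \<noteq> 0}"]
    unfolding test_functions_def by (auto simp: Int_absorb1)
qed

section \<open>From vanishing box integrals to vanishing almost everywhere\<close>

lemma zero_box_integrals_imp_AE_0:
  fixes g :: "'a::euclidean_space \<Rightarrow> real"
  assumes g: "integrable lborel g"
    and box: "\<And>a b. (\<integral>x\<in>box a b. g x \<partial>lborel) = 0"
    and UNIV: "(\<integral>x. g x \<partial>lborel) = 0"
  shows "AE x in lborel. g x = 0"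
proof -
  have gm [measurable]: "g \<in> borel_measurable borel"
    using g by auto
  have si: "set_integrable lborel A g" if "A \<in> sets borel" for A
    unfolding set_integrable_def using that g by (intro integrable_mult_indicator) auto
  have "(\<integral>x\<in>A. g x \<partial>lborel) = 0" if "A \<in> sets borel" for A
  proof -
    \<comment> \<open>Dynkin's argument: boxes are stable under intersection and generate the Borel
      sets, and the sets with zero integral are closed under complements and countable disjoint
      unions. The whole space is not a box, so complements need its integral separately.\<close>
    have "Int_stable (range (\<lambda>(a, b). box a b :: 'a set))"
      by (auto simp: Int_stable_def box_Int_box intro!: image_eqI)
    moreover have "range (\<lambda>(a, b). box a b :: 'a set) \<subseteq> Pow UNIV" by simp
    moreover have "A \<in> sigma_sets UNIV (range (\<lambda>(a, b). box a b :: 'a set))"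
      using that by (simp add: borel_eq_box)
    ultimately show ?thesis
    proof (induction rule: sigma_sets_induct_disjoint)
      case (basic A)
      then show ?case using box by auto
    next
      case empty
      then show ?case by (simp add: set_lebesgue_integral_def)
    next
      case (compl A)
      then have A [measurable]: "A \<in> sets borel" by (simp add: borel_eq_box)
      have "(\<integral>x\<in>A \<union> (UNIV - A). g x \<partial>lborel) = (\<integral>x\<in>A. g x \<partial>lborel) + (\<integral>x\<in>UNIV - A. g x \<partial>lborel)"
        by (rule set_integral_Un) (auto intro!: si)
      then show ?case
        using compl UNIV by (simp add: set_lebesgue_integral_def)
    next
      case (union A)
      then have A: "A i \<in> sets borel" for i by (auto simp: borel_eq_box)
      have "(\<integral>x\<in>(\<Union>i. A i). g x \<partial>lborel) = (\<Sum>i. (\<integral>x\<in>A i. g x \<partial>lborel))"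
        by (rule lebesgue_integral_countable_add)
          (use union A in \<open>auto intro!: si simp: disjoint_family_on_def\<close>)
      then show ?case using union by simp
    qed
  qed
  then show ?thesis
    \<comment> \<open>\<open>g\<close> and 0 have the same integral over every Borel set, so they
      agree as densities.\<close>
    using density_unique_real[OF g, of "\<lambda>x. 0"] by (simp add: set_lebesgue_integral_def)
qed

text \<open>Letting box bumps increase to indicators turns orthogonality into zero integrals over
  boxes whose closure lies in \<open>\<Omega>\<close>. The Dynkin argument is then applied to
  \<open>g\<close> cut off to one such box at a time, and countably many closed boxes cover
  \<open>\<Omega>\<close>.\<close>

lemma AE_0_if_orthogonal_to_test_functions:
  fixes g :: "real^'n \<Rightarrow> real"
  assumes \<Omega>: "open \<Omega>" "bounded \<Omega>"
    and g: "integrable (lebesgue_on \<Omega>) g"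
    and orth: "\<And>\<phi>. \<phi> \<in> test_functions \<Omega> \<Longrightarrow> (\<integral>x. g x * \<phi> x \<partial>lebesgue_on \<Omega>) = 0"
  shows "AE x in lebesgue_on \<Omega>. g x = 0"
proof -
  have [simp]: "\<Omega> \<in> sets lebesgue"
    using \<Omega> by (simp add: borel_open)
  have box: "(\<integral>x. indicator (box a b) x * g x \<partial>lebesgue_on \<Omega>) = 0" if "cbox a b \<subseteq> \<Omega>" for a b
  proof -
    have "(\<lambda>k. \<integral>x. g x * box_bump a b k x \<partial>lebesgue_on \<Omega>) \<longlonglongrightarrow> (\<integral>x. g x * indicator (box a b) x \<partial>lebesgue_on \<Omega>)"
    \<comment> \<open>The bumps lie between 0 and 1, so \<open>\<bar>g\<bar>\<close>
      dominates.\<close>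
    proof (rule integral_dominated_convergence[where w = "\<lambda>x. \<bar>g x\<bar>"])
      have "box_bump a b k \<in> borel_measurable (lebesgue_on \<Omega>)" for k
      proof -
        have "continuous_on UNIV (box_bump a b k)"
          using box_bump_test_function[OF that, of k] unfolding test_functions_def
          by (metis (no_types, lifting) continuous_at_imp_continuous_on differentiable_imp_continuous_within
              mem_Collect_eq partials_Nil)
        then show ?thesis
          by (intro measurable_restrict_space1 measurable_completion)
            (simp add: borel_measurable_continuous_onI)
      qed
      then show "(\<lambda>x. g x * box_bump a b k x) \<in> borel_measurable (lebesgue_on \<Omega>)" for k
        using g by auto
      have "indicat_real (box a b) \<in> borel_measurable (lebesgue_on \<Omega>)"
        by (intro measurable_restrict_space1 measurable_completion) simp
      then show "(\<lambda>x. g x * indicator (box a b) x) \<in> borel_measurable (lebesgue_on \<Omega>)"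
        using g by auto
    qed (use g in \<open>auto intro!: tendsto_intros box_bump_tendsto AE_I2 mult_left_le
            simp: abs_mult box_bump_bounds abs_of_nonneg\<close>)
    then show ?thesis
      using orth[OF box_bump_test_function[OF that]] by (simp add: LIMSEQ_const_iff mult.commute)
  qed
  have "AE x in lebesgue. x \<in> cbox c d \<longrightarrow> g x = 0" if cd: "cbox c d \<subseteq> \<Omega>" for c d
  proof -
    let ?g = "\<lambda>x. indicator (box c d) x * g x"
    have boxsub: "box c d \<subseteq> \<Omega>"
      using cd box_subset_cbox by blast
    have eq: "indicat_real \<Omega> x * ?g x = ?g x" for x
      using boxsub by (auto simp: indicator_def)
    have "integrable (lebesgue_on \<Omega>) ?g"
      using integrable_mult_indicator[OF _ g, of "box c d"] boxsub
      by (simp add: sets_restrict_space_iff)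
    then have ig: "integrable lebesgue ?g"
      by (subst (asm) integrable_restrict_space) (simp_all add: eq)
    \<comment> \<open>\<open>g\<close> is only Lebesgue measurable, while the Dynkin argument runs
      over Borel sets; hence a Borel representative of the cut-off function.\<close>
    obtain g' where g' [measurable]: "g' \<in> borel_measurable lborel" and ae: "AE x in lborel. ?g x = g' x"
      using completion_ex_borel_measurable_real[of ?g lborel] ig by blast
    have ae': "AE x in lebesgue. ?g x = g' x"
      by (rule AE_completion) (rule ae)
    have ig': "integrable lborel g'"
      using integrable_cong_AE_imp[OF ig _ ae'] integrable_completion[of g' lborel] g'
        measurable_completion[OF g'] by simp
    have box': "(\<integral>x\<in>box a b. g' x \<partial>lborel) = 0" for a b
    proof -
      \<comment> \<open>\<open>e\<close> and \<open>f\<close> are the corners of the intersection of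
        the two boxes. Its closed box still lies in \<open>\<Omega>\<close>, so the fact
        \<open>box\<close> applies to it.\<close>
      define e where "e = (\<Sum>i\<in>Basis. max (a \<bullet> i) (c \<bullet> i) *\<^sub>R i)"
      define f where "f = (\<Sum>i\<in>Basis. min (b \<bullet> i) (d \<bullet> i) *\<^sub>R i)"
      have ef: "box a b \<inter> box c d = box e f" "cbox a b \<inter> cbox c d = cbox e f"
        by (simp_all add: e_def f_def box_Int_box Int_interval)
      have "(\<integral>x\<in>box a b. g' x \<partial>lborel) = (\<integral>x. indicator (box a b) x * g' x \<partial>lebesgue)"
        unfolding set_lebesgue_integral_def by (subst integral_completion) auto
      also have "\<dots> = (\<integral>x. indicator (box a b) x * ?g x \<partial>lebesgue)"
      proof (rule integral_cong_AE)
        show "(\<lambda>x. indicator (box a b) x * g' x) \<in> borel_measurable lebesgue"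
          by (rule measurable_completion) measurable
        show "(\<lambda>x. indicator (box a b) x * ?g x) \<in> borel_measurable lebesgue"
          by (rule borel_measurable_times[OF _ borel_measurable_integrable[OF ig]])
            (simp add: measurable_completion)
        show "AE x in lebesgue. indicator (box a b) x * g' x = indicator (box a b) x * ?g x"
          using ae' by eventually_elim simp
      qed
      also have "\<dots> = (\<integral>x. indicator \<Omega> x *\<^sub>R (indicator (box e f) x * g x) \<partial>lebesgue)"
        using boxsub by (intro Bochner_Integration.integral_cong) (auto simp: indicator_def simp flip: ef)
      also have "\<dots> = (\<integral>x. indicator (box e f) x * g x \<partial>lebesgue_on \<Omega>)"
        by (subst integral_restrict_space) simp_all
      also have "\<dots> = 0"
        using cd ef by (intro box) auto
      finally show ?thesis .
    qed
    have UNIV': "(\<integral>x. g' x \<partial>lborel) = 0"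
    proof -
      \<comment> \<open>\<open>g'\<close> vanishes almost everywhere off \<open>box c d\<close>, so
        its total integral is one of the box integrals.\<close>
      have "(\<integral>x. g' x \<partial>lborel) = (\<integral>x\<in>box c d. g' x \<partial>lborel)"
        unfolding set_lebesgue_integral_def
        by (rule integral_cong_AE) (use ae in \<open>auto simp: indicator_def elim!: eventually_mono\<close>)
      then show ?thesis by (simp add: box')
    qed
    have "AE x in lborel. g' x = 0"
      using zero_box_integrals_imp_AE_0[OF ig' box' UNIV'] .
    \<comment> \<open>The cut-off used the open box while the covering below uses closed ones; the
      difference is a null set.\<close>
    moreover have "AE x in lborel. x \<notin> cbox c d - box c d"
      by (rule AE_not_in[OF null_sets_cbox_Diff_box])
    ultimately have "AE x in lborel. x \<in> cbox c d \<longrightarrow> g x = 0"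
      using ae by eventually_elim (auto simp: indicator_def split: if_splits)
    then show ?thesis
      by (rule AE_completion)
  qed
  moreover obtain \<D> where \<D>: "countable \<D>" "\<D> \<subseteq> Pow \<Omega>" "\<And>X. X \<in> \<D> \<Longrightarrow> \<exists>a b. X = cbox a b" "\<Union>\<D> = \<Omega>"
    using open_countable_Union_open_cbox[OF \<Omega>(1)] by metis
  ultimately have "AE x in lebesgue. \<forall>X\<in>\<D>. x \<in> X \<longrightarrow> g x = 0"
    unfolding AE_ball_countable[OF \<D>(1)] by blast
  then have "AE x in lebesgue. x \<in> \<Omega> \<longrightarrow> g x = 0"
    using \<D>(4) by (auto elim!: eventually_mono)
  then show ?thesis
    by (simp add: AE_restrict_space_iff)
qed

section \<open>The space of square-integrable functions\<close>

lemma L2_iff: "f \<in> L2 \<Omega> \<longleftrightarrow> f \<in> borel_measurable (lebesgue_on \<Omega>) \<and> integrable (lebesgue_on \<Omega>) (\<lambda>x. (norm (f x))\<^sup>2)"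
  by (simp add: L2_def)

lemma L2_measurable: "f \<in> L2 \<Omega> \<Longrightarrow> f \<in> borel_measurable (lebesgue_on \<Omega>)"
  by (simp add: L2_def)

lemma L2_dominated:
  fixes f :: "real^'n \<Rightarrow> 'b::euclidean_space" and g :: "real^'n \<Rightarrow> 'c::euclidean_space"
  assumes "f \<in> L2 \<Omega>" "g \<in> borel_measurable (lebesgue_on \<Omega>)" "\<And>x. norm (g x) \<le> C * norm (f x)"
  shows "g \<in> L2 \<Omega>"
proof -
  have "integrable (lebesgue_on \<Omega>) (\<lambda>x. C\<^sup>2 * (norm (f x))\<^sup>2)"
    using assms by (simp add: L2_iff)
  then have "integrable (lebesgue_on \<Omega>) (\<lambda>x. (norm (g x))\<^sup>2)"
  proof (rule Bochner_Integration.integrable_bound)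
    show "AE x in lebesgue_on \<Omega>. norm ((norm (g x))\<^sup>2) \<le> norm (C\<^sup>2 * (norm (f x))\<^sup>2)"
      using assms(3) by (intro AE_I2) (simp add: power_mono flip: power_mult_distrib)
  qed (use assms in measurable)
  then show ?thesis using assms by (simp add: L2_iff)
qed

lemma L2_scaleR: "f \<in> L2 \<Omega> \<Longrightarrow> (\<lambda>x. c *\<^sub>R f x) \<in> L2 \<Omega>"
  by (rule L2_dominated[where C = "\<bar>c\<bar>"]) (auto simp: L2_iff)

lemma L2_add:
  assumes "f \<in> L2 \<Omega>" "g \<in> L2 \<Omega>"
  shows "(\<lambda>x. f x + g x) \<in> L2 \<Omega>"
proof -
  have "integrable (lebesgue_on \<Omega>) (\<lambda>x. 2 * (norm (f x))\<^sup>2 + 2 * (norm (g x))\<^sup>2)"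
    using assms by (simp add: L2_iff)
  then have "integrable (lebesgue_on \<Omega>) (\<lambda>x. (norm (f x + g x))\<^sup>2)"
  proof (rule Bochner_Integration.integrable_bound)
    have "(norm (f x + g x))\<^sup>2 \<le> 2 * (norm (f x))\<^sup>2 + 2 * (norm (g x))\<^sup>2" for x
    proof -
      have "(norm (f x + g x))\<^sup>2 \<le> (norm (f x) + norm (g x))\<^sup>2"
        by (simp add: norm_triangle_ineq power_mono)
      also have "\<dots> \<le> 2 * (norm (f x))\<^sup>2 + 2 * (norm (g x))\<^sup>2"
        using sum_squares_bound[of "norm (f x)" "norm (g x)"] by (simp add: power2_sum)
      finally show ?thesis .
    qed
    then show "AE x in lebesgue_on \<Omega>. norm ((norm (f x + g x))\<^sup>2) \<le> norm (2 * (norm (f x))\<^sup>2 + 2 * (norm (g x))\<^sup>2)"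
      by (intro AE_I2) simp
  qed (use L2_measurable[OF assms(1)] L2_measurable[OF assms(2)] in measurable)
  then show ?thesis using assms by (simp add: L2_iff borel_measurable_add)
qed

lemma L2_diff: "f \<in> L2 \<Omega> \<Longrightarrow> g \<in> L2 \<Omega> \<Longrightarrow> (\<lambda>x. f x - g x) \<in> L2 \<Omega>"
  using L2_add[OF _ L2_scaleR[of g \<Omega> "-1"], of f] by simp

lemma L2_sum: "(\<And>i. i \<in> A \<Longrightarrow> f i \<in> L2 \<Omega>) \<Longrightarrow> (\<lambda>x. \<Sum>i\<in>A. f i x) \<in> L2 \<Omega>"
  by (induction A rule: infinite_finite_induct) (simp_all add: L2_add, simp_all add: L2_iff)

lemma integrable_inner_L2:
  assumes "f \<in> L2 \<Omega>" "g \<in> L2 \<Omega>"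
  shows "integrable (lebesgue_on \<Omega>) (\<lambda>x. f x \<bullet> g x)"
proof -
  have "integrable (lebesgue_on \<Omega>) (\<lambda>x. (norm (f x))\<^sup>2 + (norm (g x))\<^sup>2)"
    using assms by (simp add: L2_iff)
  then show ?thesis
  proof (rule Bochner_Integration.integrable_bound)
    have "\<bar>f x \<bullet> g x\<bar> \<le> (norm (f x))\<^sup>2 + (norm (g x))\<^sup>2" for x
      using Cauchy_Schwarz_ineq2[of "f x" "g x"] sum_squares_bound[of "norm (f x)" "norm (g x)"]
        mult_nonneg_nonneg[OF norm_ge_zero[of "f x"] norm_ge_zero[of "g x"]] by linarith
    then show "AE x in lebesgue_on \<Omega>. norm (f x \<bullet> g x) \<le> norm ((norm (f x))\<^sup>2 + (norm (g x))\<^sup>2)"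
      by (intro AE_I2) simp
  qed (use assms L2_measurable in \<open>auto intro: borel_measurable_inner\<close>)
qed

lemma l2_norm_nonneg [simp]: "0 \<le> l2_norm \<Omega> f"
  by (simp add: l2_norm_def)

lemma l2_norm_eq_sqrt_inner: "l2_norm \<Omega> f = sqrt (l2_inner \<Omega> f f)"
  by (simp add: l2_norm_def l2_inner_def power2_norm_eq_inner)

lemma l2_inner_self_nonneg: "0 \<le> l2_inner \<Omega> f f"
  by (simp add: l2_inner_def)

lemma l2_norm_power2: "(l2_norm \<Omega> f)\<^sup>2 = l2_inner \<Omega> f f"
  by (simp add: l2_norm_eq_sqrt_inner l2_inner_self_nonneg)

lemma l2_inner_commute: "l2_inner \<Omega> f g = l2_inner \<Omega> g f"
  by (simp add: l2_inner_def inner_commute)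

lemma l2_inner_diff_left:
  "\<lbrakk>f \<in> L2 \<Omega>; g \<in> L2 \<Omega>; k \<in> L2 \<Omega>\<rbrakk> \<Longrightarrow> l2_inner \<Omega> (\<lambda>x. f x - g x) k = l2_inner \<Omega> f k - l2_inner \<Omega> g k"
  by (simp add: l2_inner_def inner_diff_left integrable_inner_L2)

lemma l2_inner_add_left:
  "\<lbrakk>f \<in> L2 \<Omega>; g \<in> L2 \<Omega>; k \<in> L2 \<Omega>\<rbrakk> \<Longrightarrow> l2_inner \<Omega> (\<lambda>x. f x + g x) k = l2_inner \<Omega> f k + l2_inner \<Omega> g k"
  by (simp add: l2_inner_def inner_add_left integrable_inner_L2)

lemma l2_inner_scaleR_left: "l2_inner \<Omega> (\<lambda>x. c *\<^sub>R f x) k = c * l2_inner \<Omega> f k"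
  by (simp add: l2_inner_def)

lemma l2_inner_scaleR_right: "l2_inner \<Omega> f (\<lambda>x. c *\<^sub>R k x) = c * l2_inner \<Omega> f k"
  by (simp add: l2_inner_def)

lemma l2_inner_diff_right:
  "\<lbrakk>f \<in> L2 \<Omega>; g \<in> L2 \<Omega>; k \<in> L2 \<Omega>\<rbrakk> \<Longrightarrow> l2_inner \<Omega> k (\<lambda>x. f x - g x) = l2_inner \<Omega> k f - l2_inner \<Omega> k g"
  by (simp add: l2_inner_def inner_diff_right integrable_inner_L2)

lemma l2_inner_cong_AE:
  assumes "f \<in> borel_measurable (lebesgue_on \<Omega>)" "f' \<in> borel_measurable (lebesgue_on \<Omega>)"
    "g \<in> borel_measurable (lebesgue_on \<Omega>)" "g' \<in> borel_measurable (lebesgue_on \<Omega>)"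
    "AE x in lebesgue_on \<Omega>. f x = f' x" "AE x in lebesgue_on \<Omega>. g x = g' x"
  shows "l2_inner \<Omega> f g = l2_inner \<Omega> f' g'"
  unfolding l2_inner_def using assms(5,6)
  by (intro integral_cong_AE borel_measurable_inner assms) (auto elim: eventually_elim2)

lemma l2_norm_cong_AE:
  assumes "f \<in> borel_measurable (lebesgue_on \<Omega>)" "f' \<in> borel_measurable (lebesgue_on \<Omega>)"
    "AE x in lebesgue_on \<Omega>. f x = f' x"
  shows "l2_norm \<Omega> f = l2_norm \<Omega> f'"
  unfolding l2_norm_eq_sqrt_inner by (intro arg_cong[where f = sqrt] l2_inner_cong_AE assms)

lemma l2_inner_mono:
  assumes "f \<in> L2 \<Omega>" "g \<in> L2 \<Omega>" "f' \<in> L2 \<Omega>" "g' \<in> L2 \<Omega>" "\<And>x. f x \<bullet> g x \<le> f' x \<bullet> g' x"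
  shows "l2_inner \<Omega> f g \<le> l2_inner \<Omega> f' g'"
  unfolding l2_inner_def by (intro integral_mono integrable_inner_L2 assms)

text \<open>The form \<open>s^2 a - 2 s t b + t^2 c\<close> is the squared norm of
  \<open>s f - t g\<close>, hence nonnegative; suitable \<open>s\<close>, \<open>t\<close> give
  \<open>b^2 \<le> a c\<close>. Since \<open>l2_norm\<close> is only a seminorm on functions,
  \<open>c = 0\<close> is treated algebraically.\<close>

lemma l2_cauchy_schwarz:
  assumes f: "f \<in> L2 \<Omega>" and g: "g \<in> L2 \<Omega>"
  shows "\<bar>l2_inner \<Omega> f g\<bar> \<le> l2_norm \<Omega> f * l2_norm \<Omega> g"
proof -
  let ?a = "l2_inner \<Omega> f f" and ?b = "l2_inner \<Omega> f g" and ?c = "l2_inner \<Omega> g g"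
  have q: "0 \<le> s\<^sup>2 * ?a - 2 * s * t * ?b + t\<^sup>2 * ?c" for s t
  proof -
    have s: "(\<lambda>x. s *\<^sub>R f x) \<in> L2 \<Omega>" and t: "(\<lambda>x. t *\<^sub>R g x) \<in> L2 \<Omega>"
      using f g by (auto intro: L2_scaleR)
    have "0 \<le> l2_inner \<Omega> (\<lambda>x. s *\<^sub>R f x - t *\<^sub>R g x) (\<lambda>x. s *\<^sub>R f x - t *\<^sub>R g x)"
      by (rule l2_inner_self_nonneg)
    also have "\<dots> = s * (s * ?a) - t * (s * ?b) - (s * (t * ?b) - t * (t * ?c))"
      unfolding l2_inner_diff_left[OF s t L2_diff[OF s t]] l2_inner_diff_right[OF s t s]
        l2_inner_diff_right[OF s t t]
      by (simp only: l2_inner_scaleR_left l2_inner_scaleR_right l2_inner_commute[of \<Omega> g f])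
    also have "\<dots> = s\<^sup>2 * ?a - 2 * s * t * ?b + t\<^sup>2 * ?c"
      by (simp add: power2_eq_square algebra_simps)
    finally show ?thesis .
  qed
  have "?b\<^sup>2 \<le> ?a * ?c"
  proof (cases "?c = 0")
    case True
    have "?b = 0"
    proof (rule ccontr)
      assume "?b \<noteq> 0"
      \<comment> \<open>With \<open>s = 1\<close> this \<open>t\<close> makes the form equal to
        \<open>a - (a + 1) = -1\<close>.\<close>
      then have "2 * 1 * ((?a + 1) / (2 * ?b)) * ?b = ?a + 1"
        by simp
      then show False
        using q[of 1 "(?a + 1) / (2 * ?b)"] True by simp
    qed
    then show ?thesis using True by simp
  next
    case False
    then have "?c > 0" using l2_inner_self_nonneg[of \<Omega> g] by linarith
    \<comment> \<open>The choice \<open>s = c\<close>, \<open>t = b\<close>.\<close>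
    moreover have "0 \<le> ?c * (?a * ?c - ?b\<^sup>2)"
      using q[of ?c ?b] by (simp add: power2_eq_square algebra_simps)
    ultimately show ?thesis
      by (simp add: zero_le_mult_iff)
  qed
  then have "sqrt (?b\<^sup>2) \<le> sqrt (?a * ?c)"
    by (rule real_sqrt_le_mono)
  then show ?thesis
    by (simp add: l2_norm_eq_sqrt_inner real_sqrt_mult)
qed

lemma l2_norm_triangle:
  assumes f: "f \<in> L2 \<Omega>" and g: "g \<in> L2 \<Omega>"
  shows "l2_norm \<Omega> (\<lambda>x. f x + g x) \<le> l2_norm \<Omega> f + l2_norm \<Omega> g"
proof (rule power2_le_imp_le)
  have "l2_inner \<Omega> (\<lambda>x. f x + g x) (\<lambda>x. f x + g x) = l2_inner \<Omega> f f + 2 * l2_inner \<Omega> f g + l2_inner \<Omega> g g"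
    using l2_inner_add_left[OF f g L2_add[OF f g]] l2_inner_add_left[OF f g f] l2_inner_add_left[OF f g g]
      l2_inner_commute[of \<Omega> f "\<lambda>x. f x + g x"] l2_inner_commute[of \<Omega> g "\<lambda>x. f x + g x"]
      l2_inner_commute[of \<Omega> g f]
    by linarith
  then show "(l2_norm \<Omega> (\<lambda>x. f x + g x))\<^sup>2 \<le> (l2_norm \<Omega> f + l2_norm \<Omega> g)\<^sup>2"
    using l2_cauchy_schwarz[OF f g] by (simp add: l2_norm_power2 power2_sum)
qed simp

lemma l2_norm_minus: "l2_norm \<Omega> (\<lambda>x. - f x) = l2_norm \<Omega> f"
  by (simp add: l2_norm_def)

lemma l2_norm_scaleR: "l2_norm \<Omega> (\<lambda>x. c *\<^sub>R f x) = \<bar>c\<bar> * l2_norm \<Omega> f"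
  by (simp add: l2_norm_def power_mult_distrib real_sqrt_mult)

lemma l2_norm_mono:
  assumes "f \<in> L2 \<Omega>" "g \<in> L2 \<Omega>" "\<And>x. norm (f x) \<le> norm (g x)"
  shows "l2_norm \<Omega> f \<le> l2_norm \<Omega> g"
  unfolding l2_norm_def
  using assms by (intro real_sqrt_le_mono integral_mono) (auto simp: L2_iff power_mono)

lemma l2_norm_triangle_diff:
  assumes f: "f \<in> L2 \<Omega>" and g: "g \<in> L2 \<Omega>"
  shows "l2_norm \<Omega> (\<lambda>x. f x - g x) \<le> l2_norm \<Omega> f + l2_norm \<Omega> g"
  using l2_norm_triangle[OF f L2_scaleR[OF g, of "-1"]] by (simp add: l2_norm_minus)

section \<open>The regularized stress\<close>

text \<open>For positive \<open>\<epsilon>\<close> this is the gradient of the smooth convex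
  function \<open>reg_norm \<epsilon>\<close>, which is why it is monotone.\<close>

definition yield_stress :: "real \<Rightarrow> real^'n^'n \<Rightarrow> real^'n^'n" where
  "yield_stress \<epsilon> A = A /\<^sub>R reg_norm \<epsilon> A"

lemma reg_norm_pos: "\<epsilon> > 0 \<Longrightarrow> 0 < reg_norm \<epsilon> A"
  by (simp add: reg_norm_def add_nonneg_pos)

lemma reg_norm_power2: "(reg_norm \<epsilon> A)\<^sup>2 = A \<bullet> A + \<epsilon>\<^sup>2"
  by (simp add: reg_norm_def)

lemma reg_norm_ge: "\<epsilon> > 0 \<Longrightarrow> \<epsilon> \<le> reg_norm \<epsilon> A"
  using real_sqrt_le_mono[of "\<epsilon>\<^sup>2" "A \<bullet> A + \<epsilon>\<^sup>2"] by (simp add: reg_norm_def)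

lemma norm_le_reg_norm: "norm A \<le> reg_norm \<epsilon> A"
  by (simp add: reg_norm_def norm_eq_sqrt_inner)

text \<open>Viewing the regularized norm as a genuine norm in a product space yields its
  Cauchy-Schwarz and reverse triangle inequalities at once.\<close>

lemma reg_norm_eq_norm_Pair: "reg_norm \<epsilon> A = norm (A, \<epsilon>)"
  by (simp add: reg_norm_def norm_Pair power2_norm_eq_inner)

lemma inner_le_reg_norm: "A \<bullet> B + \<epsilon>\<^sup>2 \<le> reg_norm \<epsilon> A * reg_norm \<epsilon> B"
  using norm_cauchy_schwarz[of "(A, \<epsilon>)" "(B, \<epsilon>)"]
  by (simp add: reg_norm_eq_norm_Pair power2_eq_square)

lemma reg_norm_diff_le: "\<bar>reg_norm \<epsilon> A - reg_norm \<epsilon> B\<bar> \<le> norm (A - B)"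
  using norm_triangle_ineq3[of "(A, \<epsilon>)" "(B, \<epsilon>)"]
  by (simp add: reg_norm_eq_norm_Pair norm_Pair)

text \<open>With \<open>a\<close>, \<open>b\<close> the regularized norms, the product equals
  \<open>(1/a + 1/b) * (a b - (A \<bullet> B + \<epsilon>^2))\<close>, and the second factor is
  nonnegative by Cauchy-Schwarz for \<open>(A, \<epsilon>)\<close> and
  \<open>(B, \<epsilon>)\<close>.\<close>

lemma yield_stress_monotone:
  assumes "\<epsilon> > 0"
  shows "0 \<le> (yield_stress \<epsilon> A - yield_stress \<epsilon> B) \<bullet> (A - B)"
proof -
  define a b where "a = reg_norm \<epsilon> A" and "b = reg_norm \<epsilon> B"
  have a: "a > 0" and b: "b > 0"
    by (simp_all add: a_def b_def reg_norm_pos assms)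
  have "A \<bullet> A = a * a - \<epsilon>\<^sup>2" "B \<bullet> B = b * b - \<epsilon>\<^sup>2" "a * inverse a = 1" "b * inverse b = 1"
    using reg_norm_power2[of \<epsilon> A] reg_norm_power2[of \<epsilon> B] a b
    by (auto simp: a_def b_def power2_eq_square)
  then have "(yield_stress \<epsilon> A - yield_stress \<epsilon> B) \<bullet> (A - B) =
      (inverse a + inverse b) * (a * b - (A \<bullet> B + \<epsilon>\<^sup>2))"
    unfolding yield_stress_def inner_diff_left inner_diff_right inner_scaleR_left
      inner_commute[of B A] a_def[symmetric] b_def[symmetric]
    by algebra
  also have "\<dots> \<ge> 0"
    using a b inner_le_reg_norm[of A B \<epsilon>] unfolding a_def b_def
    by (intro mult_nonneg_nonneg add_nonneg_nonneg) auto
  finally show ?thesis .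
qed

text \<open>The two stresses are the matrix components of the unit vectors
  \<open>(A, \<epsilon>)/a\<close> and \<open>(B, \<epsilon>)/b\<close>. The squared distance of
  these is \<open>2 (a b - (A \<bullet> B + \<epsilon>^2)) / (a b)\<close>; the last components only
  reduce it. Then \<open>a, b \<ge> \<epsilon>\<close> and \<open>2 a b \<le> a^2 + b^2\<close>
  finish.\<close>

lemma yield_stress_lipschitz:
  assumes "\<epsilon> > 0"
  shows "norm (yield_stress \<epsilon> A - yield_stress \<epsilon> B) \<le> inverse \<epsilon> * norm (A - B)"
proof (rule power2_le_imp_le)
  define a b where "a = reg_norm \<epsilon> A" and "b = reg_norm \<epsilon> B"
  have a: "a > 0" and b: "b > 0"
    by (simp_all add: a_def b_def reg_norm_pos assms)
  have AB: "A \<bullet> A = a * a - \<epsilon>\<^sup>2" "B \<bullet> B = b * b - \<epsilon>\<^sup>2"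
    using reg_norm_power2[of \<epsilon> A] reg_norm_power2[of \<epsilon> B]
    by (auto simp: a_def b_def power2_eq_square)
  have le: "A \<bullet> B + \<epsilon>\<^sup>2 \<le> a * b"
    using inner_le_reg_norm by (simp add: a_def b_def)
  have "a * inverse a = 1" "b * inverse b = 1"
    using a b by auto
  with AB have "(norm (yield_stress \<epsilon> A - yield_stress \<epsilon> B))\<^sup>2 =
      2 * (a * b - (A \<bullet> B + \<epsilon>\<^sup>2)) * inverse a * inverse b - (\<epsilon> * inverse a - \<epsilon> * inverse b)\<^sup>2"
    unfolding yield_stress_def power2_norm_eq_inner inner_diff_left inner_diff_right
      inner_scaleR_left inner_scaleR_right inner_commute[of B A] a_def[symmetric] b_def[symmetric]
    by algebra
  also have "\<dots> \<le> 2 * (a * b - (A \<bullet> B + \<epsilon>\<^sup>2)) * inverse a * inverse b"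
    by simp
  also have "\<dots> \<le> 2 * (a * b - (A \<bullet> B + \<epsilon>\<^sup>2)) * inverse \<epsilon> * inverse \<epsilon>"
  proof -
    have "inverse a \<le> inverse \<epsilon>" "inverse b \<le> inverse \<epsilon>"
      using assms by (auto simp: a_def b_def intro!: le_imp_inverse_le reg_norm_ge)
    then show ?thesis
      using a b assms le by (intro mult_mono mult_nonneg_nonneg) auto
  qed
  also have "\<dots> \<le> (norm (A - B))\<^sup>2 * inverse \<epsilon> * inverse \<epsilon>"
  proof -
    have "(norm (A - B))\<^sup>2 = a * a + b * b - 2 * (A \<bullet> B) - 2 * \<epsilon>\<^sup>2"
      using AB by (simp add: power2_norm_eq_inner inner_diff_left inner_diff_right inner_commute)
    then have "2 * (a * b - (A \<bullet> B + \<epsilon>\<^sup>2)) \<le> (norm (A - B))\<^sup>2"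
      using sum_squares_bound[of a b] by (simp add: power2_eq_square algebra_simps)
    then show ?thesis
      using assms by (intro mult_right_mono) auto
  qed
  also have "\<dots> = (inverse \<epsilon> * norm (A - B))\<^sup>2"
    by (simp add: power2_eq_square)
  finally show "(norm (yield_stress \<epsilon> A - yield_stress \<epsilon> B))\<^sup>2 \<le> (inverse \<epsilon> * norm (A - B))\<^sup>2" .
qed (use assms in simp)

text \<open>Splitting off \<open>(A - B)/a\<close> leaves \<open>(1/a - 1/b) B\<close>, whose norm
  is \<open>\<bar>b - a\<bar>/a\<close> times \<open>norm B / b\<close>, with the last ratio at most
  1. The weight involves \<open>A\<close> alone, matching the smallness condition on
  \<open>h\<close>.\<close>

lemma yield_stress_local_lipschitz:
  assumes "\<epsilon> > 0"
  shows "norm (yield_stress \<epsilon> A - yield_stress \<epsilon> B) \<le> 2 * norm (A - B) / reg_norm \<epsilon> A"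
proof -
  let ?a = "reg_norm \<epsilon> A" and ?b = "reg_norm \<epsilon> B"
  have a: "?a > 0" and b: "?b > 0" by (simp_all add: reg_norm_pos assms)
  have "(?b - ?a) / (?a * ?b) = inverse ?a - inverse ?b"
    using a b by (simp add: divide_simps)
  then have "yield_stress \<epsilon> A - yield_stress \<epsilon> B = (A - B) /\<^sub>R ?a + ((?b - ?a) / (?a * ?b)) *\<^sub>R B"
    by (simp add: yield_stress_def scaleR_diff_right scaleR_diff_left)
  also have "norm \<dots> \<le> norm (A - B) / ?a + \<bar>?b - ?a\<bar> / ?a * (norm B / ?b)"
    using a b by (intro order_trans[OF norm_triangle_ineq]) (simp add: abs_mult divide_inverse)
  also have "\<dots> \<le> norm (A - B) / ?a + norm (A - B) / ?a * 1"
    using a b reg_norm_diff_le[of \<epsilon> B A] norm_le_reg_norm[of B \<epsilon>]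
    by (intro add_left_mono mult_mono divide_right_mono) (auto simp: norm_minus_commute)
  finally show ?thesis by simp
qed

text \<open>Cauchy-Schwarz of the diagonal against the all-ones vector; the origin of the factor
  \<open>sqrt d\<close> in the theorem.\<close>

lemma trace_le_sqrt_card_norm:
  fixes A :: "real^'n^'n"
  shows "\<bar>\<Sum>i\<in>UNIV. A $ i $ i\<bar> \<le> sqrt (real CARD('n)) * norm A"
proof -
  have "(\<Sum>i\<in>UNIV. A $ i $ i)\<^sup>2 \<le> (\<Sum>i\<in>(UNIV::'n set). 1\<^sup>2) * (\<Sum>i\<in>UNIV. (A $ i $ i)\<^sup>2)"
    using Cauchy_Schwarz_ineq_sum[of "\<lambda>i. 1" "\<lambda>i. A $ i $ i" UNIV] by simp
  also have "\<dots> \<le> real CARD('n) * (norm A)\<^sup>2"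
  proof -
    have "(\<Sum>i\<in>UNIV. (A $ i $ i)\<^sup>2) \<le> (\<Sum>i\<in>UNIV. \<Sum>j\<in>UNIV. (A $ i $ j)\<^sup>2)"
      by (intro sum_mono member_le_sum) auto
    also have "\<dots> = (norm A)\<^sup>2"
      by (simp only: power2_norm_eq_inner inner_vec_def) (simp add: power2_eq_square)
    finally show ?thesis by (simp add: mult_left_mono)
  qed
  finally have "sqrt ((\<Sum>i\<in>UNIV. A $ i $ i)\<^sup>2) \<le> sqrt (real CARD('n) * (norm A)\<^sup>2)"
    by (rule real_sqrt_le_mono)
  then show ?thesis by (simp add: real_sqrt_mult)
qed

section \<open>Weak derivatives and finite element spaces\<close>

lemma partials_eq_0_outside_support:
  "x \<notin> closure {x. \<phi> x \<noteq> 0} \<Longrightarrow> partials js \<phi> x = 0"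
proof (induction js arbitrary: x)
  case Nil
  then show ?case
    using closure_subset[of "{x. \<phi> x \<noteq> 0}"] by auto
next
  case (Cons j js)
  have "((\<lambda>y. 0) has_derivative (\<lambda>v. 0)) (at x)"
    by simp
  then have "(partials js \<phi> has_derivative (\<lambda>v. 0)) (at x)"
    by (rule has_derivative_transform_within_open[where s = "- closure {x. \<phi> x \<noteq> 0}"])
      (use Cons in auto)
  then show ?case
    by (simp add: partial_eqI)
qed

lemma const_in_L2:
  assumes "open \<Omega>" "bounded \<Omega>"
  shows "(\<lambda>x. c) \<in> L2 \<Omega>"
proof -
  interpret finite_measure "lebesgue_on \<Omega>"
    using assms by (intro finite_measure_lebesgue_on lmeasurable_open)
  show ?thesis by (simp add: L2_iff)
qed

text \<open>A derivative is continuous, so bounded on the compact support, and zero elsewhere;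
  bounded functions are square-integrable because \<open>\<Omega>\<close> has finite
  measure.\<close>

lemma partials_test_function_in_L2:
  assumes \<Omega>: "open \<Omega>" "bounded \<Omega>" and \<phi>: "\<phi> \<in> test_functions \<Omega>"
  shows "partials js \<phi> \<in> L2 \<Omega>"
proof -
  let ?K = "closure {x. \<phi> x \<noteq> 0}"
  have cont: "continuous_on S (partials js \<phi>)" for S
    using \<phi> unfolding test_functions_def
    by (auto intro!: continuous_at_imp_continuous_on differentiable_imp_continuous_within)
  then have "bounded (partials js \<phi> ` ?K)"
    using \<phi> by (intro compact_imp_bounded compact_continuous_image) (auto simp: test_functions_def)
  then obtain B where B: "\<And>x. x \<in> ?K \<Longrightarrow> \<bar>partials js \<phi> x\<bar> \<le> B"
    by (auto simp: bounded_iff)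
  have "\<bar>partials js \<phi> x\<bar> \<le> \<bar>B\<bar>" for x
    using B[of x] partials_eq_0_outside_support[of x \<phi> js] by fastforce
  moreover have "partials js \<phi> \<in> borel_measurable (lebesgue_on \<Omega>)"
    by (intro measurable_restrict_space1 measurable_completion)
      (simp add: borel_measurable_continuous_onI cont)
  ultimately show ?thesis
    by (intro L2_dominated[OF const_in_L2[OF \<Omega>, of "1::real"], where C = "\<bar>B\<bar>"]) auto
qed

lemma partials_diff:
  assumes "\<phi> \<in> test_functions \<Omega>" "\<psi> \<in> test_functions \<Omega>"
  shows "partials js (\<lambda>x. \<phi> x - \<psi> x) = (\<lambda>x. partials js \<phi> x - partials js \<psi> x)"
proof (induction js)
  case (Cons j js)
  have "(partials js \<phi> has_derivative frechet_derivative (partials js \<phi>) (at x)) (at x)"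
    "(partials js \<psi> has_derivative frechet_derivative (partials js \<psi>) (at x)) (at x)" for x
    using assms by (auto simp: test_functions_def simp flip: frechet_derivative_works)
  from partial_eqI[OF has_derivative_diff[OF this]]
  show ?case
    by (simp add: Cons partial_def)
qed simp

lemma test_functions_diff:
  assumes "\<phi> \<in> test_functions \<Omega>" "\<psi> \<in> test_functions \<Omega>"
  shows "(\<lambda>x. \<phi> x - \<psi> x) \<in> test_functions \<Omega>"
proof -
  let ?U = "closure {x. \<phi> x \<noteq> 0} \<union> closure {x. \<psi> x \<noteq> 0}"
  have U: "compact ?U" "?U \<subseteq> \<Omega>"
    using assms by (auto simp: test_functions_def)
  have "{x. \<phi> x - \<psi> x \<noteq> 0} \<subseteq> {x. \<phi> x \<noteq> 0} \<union> {x. \<psi> x \<noteq> 0}"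
    by auto
  then have sub: "closure {x. \<phi> x - \<psi> x \<noteq> 0} \<subseteq> ?U"
    using closure_mono by (simp flip: closure_Un)
  have "compact (closure {x. \<phi> x - \<psi> x \<noteq> 0})"
    using compact_Int_closed[OF U(1) closed_closure, of "{x. \<phi> x - \<psi> x \<noteq> 0}"]
    by (simp only: Int_absorb1[OF sub])
  moreover have "partials js (\<lambda>x. \<phi> x - \<psi> x) differentiable (at x)" for js x
    unfolding partials_diff[OF assms]
    using assms by (intro differentiable_diff) (auto simp: test_functions_def)
  ultimately show ?thesis
    using sub U(2) by (auto simp: test_functions_def)
qed

lemma integrable_times_L2:
  fixes f g :: "real^'n \<Rightarrow> real"
  shows "\<lbrakk>f \<in> L2 \<Omega>; g \<in> L2 \<Omega>\<rbrakk> \<Longrightarrow> integrable (lebesgue_on \<Omega>) (\<lambda>x. f x * g x)"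
  using integrable_inner_L2[of f \<Omega> g] by simp

context
  fixes \<Omega> :: "(real^'n) set"
  assumes \<Omega>: "open \<Omega>" "bounded \<Omega>"
begin

section \<open>Weak derivatives and the zero-trace space under differences\<close>

lemma has_weak_partials_diff:
  assumes "has_weak_partials \<Omega> js f g" "has_weak_partials \<Omega> js f' g'"
  shows "has_weak_partials \<Omega> js (\<lambda>x. f x - f' x) (\<lambda>x. g x - g' x)"
proof -
  have L: "f \<in> L2 \<Omega>" "g \<in> L2 \<Omega>" "f' \<in> L2 \<Omega>" "g' \<in> L2 \<Omega>"
    using assms by (auto simp: has_weak_partials_def)
  show ?thesis
    unfolding has_weak_partials_def
  proof (intro conjI ballI L2_diff L)
    fix \<phi> assume \<phi>: "\<phi> \<in> test_functions \<Omega>"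
    have P: "partials js \<phi> \<in> L2 \<Omega>" "\<phi> \<in> L2 \<Omega>"
      using partials_test_function_in_L2[OF \<Omega> \<phi>, of js] partials_test_function_in_L2[OF \<Omega> \<phi>, of "[]"] by auto
    show "(\<integral>x. (f x - f' x) * partials js \<phi> x \<partial>lebesgue_on \<Omega>) =
        (-1) ^ length js * (\<integral>x. (g x - g' x) * \<phi> x \<partial>lebesgue_on \<Omega>)"
      using assms \<phi> L P
      by (simp add: has_weak_partials_def left_diff_distrib integrable_times_L2 right_diff_distrib)
  qed
qed

text \<open>The difference of two candidates is a weak derivative of \<open>f - f\<close>, hence
  orthogonal to all test functions.\<close>

lemma has_weak_partials_unique:
  assumes "has_weak_partials \<Omega> js f g" "has_weak_partials \<Omega> js f g'"
  shows "AE x in lebesgue_on \<Omega>. g x = g' x"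
proof -
  have L: "g \<in> L2 \<Omega>" "g' \<in> L2 \<Omega>"
    using assms by (auto simp: has_weak_partials_def)
  have "AE x in lebesgue_on \<Omega>. g x - g' x = 0"
  proof (rule AE_0_if_orthogonal_to_test_functions[OF \<Omega>])
    show "integrable (lebesgue_on \<Omega>) (\<lambda>x. g x - g' x)"
      \<comment> \<open>On a set of finite measure the constant 1 is square-integrable, so
        multiplying by it shows integrability.\<close>
      using integrable_times_L2[OF L2_diff[OF L] const_in_L2[OF \<Omega>, of 1]] by simp
    fix \<phi> assume "\<phi> \<in> test_functions \<Omega>"
    then show "(\<integral>x. (g x - g' x) * \<phi> x \<partial>lebesgue_on \<Omega>) = 0"
      using has_weak_partials_diff[OF assms] by (simp add: has_weak_partials_def)
  qed
  then show ?thesis by simp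
qed

lemma has_weak_partials_weak_partials:
  "\<lbrakk>f \<in> sobolev \<Omega> k; length js \<le> k\<rbrakk> \<Longrightarrow> has_weak_partials \<Omega> js f (weak_partials \<Omega> js f)"
  using someI_ex[of "has_weak_partials \<Omega> js f"] by (simp add: sobolev_def weak_partials_def)

lemma weak_partials_in_L2: "\<lbrakk>f \<in> sobolev \<Omega> k; length js \<le> k\<rbrakk> \<Longrightarrow> weak_partials \<Omega> js f \<in> L2 \<Omega>"
  by (drule (1) has_weak_partials_weak_partials) (simp add: has_weak_partials_def)

lemma sobolev_in_L2: "f \<in> sobolev \<Omega> k \<Longrightarrow> f \<in> L2 \<Omega>"
  using has_weak_partials_weak_partials[of f k "[]"] by (simp add: has_weak_partials_def)

lemma sobolev_diff: "\<lbrakk>f \<in> sobolev \<Omega> k; g \<in> sobolev \<Omega> k\<rbrakk> \<Longrightarrow> (\<lambda>x. f x - g x) \<in> sobolev \<Omega> k"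
  unfolding sobolev_def using has_weak_partials_diff by blast

text \<open>Representatives picked by \<open>SOME\<close> need not respect differences pointwise;
  uniqueness gives this almost everywhere, which is why later identities for gradients carry
  \<open>AE\<close>.\<close>

lemma weak_partials_diff:
  assumes "f \<in> sobolev \<Omega> k" "g \<in> sobolev \<Omega> k" "length js \<le> k"
  shows "AE x in lebesgue_on \<Omega>.
    weak_partials \<Omega> js (\<lambda>x. f x - g x) x = weak_partials \<Omega> js f x - weak_partials \<Omega> js g x"
  by (rule has_weak_partials_unique)
    (use assms in \<open>auto intro!: has_weak_partials_weak_partials has_weak_partials_diff sobolev_diff\<close>)

text \<open>The differences of the two approximating sequences approximate the difference, by the
  triangle inequality.\<close>

lemma sobolev_zero_diff:
  assumes f: "f \<in> sobolev_zero \<Omega>" and g: "g \<in> sobolev_zero \<Omega>"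
  shows "(\<lambda>x. f x - g x) \<in> sobolev_zero \<Omega>"
proof -
  obtain \<phi> where \<phi>: "\<And>n. \<phi> n \<in> test_functions \<Omega>" "(\<lambda>n. l2_norm \<Omega> (\<lambda>x. f x - \<phi> n x)) \<longlonglongrightarrow> 0"
    "\<And>j. (\<lambda>n. l2_norm \<Omega> (\<lambda>x. weak_partials \<Omega> [j] f x - partial j (\<phi> n) x)) \<longlonglongrightarrow> 0"
    using f unfolding sobolev_zero_def by blast
  obtain \<psi> where \<psi>: "\<And>n. \<psi> n \<in> test_functions \<Omega>" "(\<lambda>n. l2_norm \<Omega> (\<lambda>x. g x - \<psi> n x)) \<longlonglongrightarrow> 0"
    "\<And>j. (\<lambda>n. l2_norm \<Omega> (\<lambda>x. weak_partials \<Omega> [j] g x - partial j (\<psi> n) x)) \<longlonglongrightarrow> 0"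
    using g unfolding sobolev_zero_def by blast
  have S: "f \<in> sobolev \<Omega> 1" "g \<in> sobolev \<Omega> 1"
    using f g by (auto simp: sobolev_zero_def)
  note L = sobolev_in_L2[OF S(1)] sobolev_in_L2[OF S(2)]
  have P: "\<phi> n \<in> L2 \<Omega>" "\<psi> n \<in> L2 \<Omega>" "partial j (\<phi> n) \<in> L2 \<Omega>" "partial j (\<psi> n) \<in> L2 \<Omega>" for n j
    using partials_test_function_in_L2[OF \<Omega> \<phi>(1), of "[]"] partials_test_function_in_L2[OF \<Omega> \<psi>(1), of "[]"]
      partials_test_function_in_L2[OF \<Omega> \<phi>(1), of "[j]"] partials_test_function_in_L2[OF \<Omega> \<psi>(1), of "[j]"]
    by auto
  have le: "l2_norm \<Omega> (\<lambda>x. (a x - b x) - (a' x - b' x)) \<le>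
      l2_norm \<Omega> (\<lambda>x. a x - a' x) + l2_norm \<Omega> (\<lambda>x. b x - b' x)"
    if "a \<in> L2 \<Omega>" "b \<in> L2 \<Omega>" "a' \<in> L2 \<Omega>" "b' \<in> L2 \<Omega>" for a b a' b' :: "real^'n \<Rightarrow> real"
    using l2_norm_triangle_diff[OF L2_diff[OF that(1,3)] L2_diff[OF that(2,4)]]
    by (simp add: algebra_simps)
  have "(\<lambda>n. l2_norm \<Omega> (\<lambda>x. (f x - g x) - (\<phi> n x - \<psi> n x))) \<longlonglongrightarrow> 0"
    by (rule tendsto_sandwich[OF _ _ tendsto_const tendsto_add_zero[OF \<phi>(2) \<psi>(2)]])
      (auto intro!: always_eventually le L P)
  moreover have "(\<lambda>n. l2_norm \<Omega> (\<lambda>x. weak_partials \<Omega> [j] (\<lambda>x. f x - g x) x -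
      partial j (\<lambda>x. \<phi> n x - \<psi> n x) x)) \<longlonglongrightarrow> 0" for j
  proof (rule tendsto_sandwich[OF _ _ tendsto_const tendsto_add_zero[OF \<phi>(3) \<psi>(3)]])
    have W: "weak_partials \<Omega> [j] f \<in> L2 \<Omega>" "weak_partials \<Omega> [j] g \<in> L2 \<Omega>"
      "weak_partials \<Omega> [j] (\<lambda>x. f x - g x) \<in> L2 \<Omega>"
      by (auto intro!: weak_partials_in_L2[of _ 1] S sobolev_diff)
    have pd: "partial j (\<lambda>x. \<phi> n x - \<psi> n x) = (\<lambda>x. partial j (\<phi> n) x - partial j (\<psi> n) x)" for n
      using partials_diff[OF \<phi>(1) \<psi>(1), of "[j]"] by simp
    \<comment> \<open>Under the norm the chosen derivative of the difference may be exchanged for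
      the difference of the chosen derivatives.\<close>
    have "l2_norm \<Omega> (\<lambda>x. weak_partials \<Omega> [j] (\<lambda>x. f x - g x) x - partial j (\<lambda>x. \<phi> n x - \<psi> n x) x) =
        l2_norm \<Omega> (\<lambda>x. (weak_partials \<Omega> [j] f x - weak_partials \<Omega> [j] g x) -
          (partial j (\<phi> n) x - partial j (\<psi> n) x))" for n
      unfolding pd
    proof (rule l2_norm_cong_AE)
      show "AE x in lebesgue_on \<Omega>.
          weak_partials \<Omega> [j] (\<lambda>x. f x - g x) x - (partial j (\<phi> n) x - partial j (\<psi> n) x) =
          weak_partials \<Omega> [j] f x - weak_partials \<Omega> [j] g x - (partial j (\<phi> n) x - partial j (\<psi> n) x)"
        using weak_partials_diff[OF S, of "[j]"] by (auto elim: eventually_mono)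
    qed (intro L2_measurable L2_diff W P)+
    then show "\<forall>\<^sub>F n in sequentially.
        l2_norm \<Omega> (\<lambda>x. weak_partials \<Omega> [j] (\<lambda>x. f x - g x) x - partial j (\<lambda>x. \<phi> n x - \<psi> n x) x) \<le>
        l2_norm \<Omega> (\<lambda>x. weak_partials \<Omega> [j] f x - partial j (\<phi> n) x) +
        l2_norm \<Omega> (\<lambda>x. weak_partials \<Omega> [j] g x - partial j (\<psi> n) x)"
      using le[OF W(1,2) P(3,4)] by simp
  qed simp
  ultimately show ?thesis
    unfolding sobolev_zero_def using sobolev_diff[OF S] test_functions_diff[OF \<phi>(1) \<psi>(1)]
    by (auto intro!: exI[of _ "\<lambda>n x. \<phi> n x - \<psi> n x"])
qed

section \<open>Gradient, strain and divergence of velocities\<close>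

lemma velocity_space_diff:
  "\<lbrakk>v \<in> velocity_space \<Omega>; w \<in> velocity_space \<Omega>\<rbrakk> \<Longrightarrow> (\<lambda>x. v x - w x) \<in> velocity_space \<Omega>"
  by (simp add: velocity_space_def sobolev_zero_diff)

lemma velocity_space_sobolev: "v \<in> velocity_space \<Omega> \<Longrightarrow> (\<lambda>x. v x $ i) \<in> sobolev \<Omega> 1"
  by (simp add: velocity_space_def sobolev_zero_def)

text \<open>A matrix field is the sum of its entries times the constant matrix units
  \<open>axis i (axis j 1)\<close>, which have norm 1.\<close>

lemma L2_matrixI:
  fixes A :: "real^'n \<Rightarrow> real^'m^'k"
  assumes "\<And>i j. (\<lambda>x. A x $ i $ j) \<in> L2 \<Omega>"
  shows "A \<in> L2 \<Omega>"
proof -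
  have "(\<lambda>x. A x $ i $ j *\<^sub>R axis i (axis j 1 :: real^'m)) \<in> L2 \<Omega>" for i j
    by (rule L2_dominated[OF assms[of i j]
          borel_measurable_scaleR[OF L2_measurable[OF assms[of i j]] borel_measurable_const], where C = 1])
      (simp add: norm_eq_sqrt_inner[of "axis _ _"] inner_axis_axis)
  then have "(\<lambda>x. \<Sum>i\<in>UNIV. \<Sum>j\<in>UNIV. A x $ i $ j *\<^sub>R axis i (axis j 1 :: real^'m)) \<in> L2 \<Omega>"
    by (intro L2_sum)
  moreover have "(\<Sum>i\<in>UNIV. \<Sum>j\<in>UNIV. B $ i $ j *\<^sub>R axis i (axis j 1)) = B" for B :: "real^'m^'k"
  proof -
    have "(B $ i $ j *\<^sub>R axis i (axis j 1)) $ a $ b = (if j = b then if i = a then B $ i $ j else 0 else 0)"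
      for i j a b
      by (simp add: axis_def)
    then show ?thesis
      by (simp add: vec_eq_iff)
  qed
  ultimately show ?thesis by simp
qed

lemma wgrad_component_in_L2: "v \<in> velocity_space \<Omega> \<Longrightarrow> (\<lambda>x. wgrad \<Omega> v x $ i $ j) \<in> L2 \<Omega>"
  by (simp add: wgrad_def weak_partials_in_L2[OF velocity_space_sobolev])

lemma strain_in_L2:
  assumes "v \<in> velocity_space \<Omega>"
  shows "strain \<Omega> v \<in> L2 \<Omega>"
proof (rule L2_matrixI)
  fix i j
  show "(\<lambda>x. strain \<Omega> v x $ i $ j) \<in> L2 \<Omega>"
    using L2_scaleR[OF L2_add[OF wgrad_component_in_L2[OF assms, of i j] wgrad_component_in_L2[OF assms, of j i]], of "1/2"]
    by (simp add: strain_def transpose_def)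
qed

lemma wdiv_in_L2: "v \<in> velocity_space \<Omega> \<Longrightarrow> wdiv \<Omega> v \<in> L2 \<Omega>"
  unfolding wdiv_def[abs_def] by (intro L2_sum wgrad_component_in_L2)

lemma wgrad_diff:
  assumes "v \<in> velocity_space \<Omega>" "w \<in> velocity_space \<Omega>"
  shows "AE x in lebesgue_on \<Omega>. wgrad \<Omega> (\<lambda>x. v x - w x) x = wgrad \<Omega> v x - wgrad \<Omega> w x"
proof -
  have "AE x in lebesgue_on \<Omega>. \<forall>i. \<forall>j. wgrad \<Omega> (\<lambda>x. v x - w x) x $ i $ j =
      wgrad \<Omega> v x $ i $ j - wgrad \<Omega> w x $ i $ j"
    using weak_partials_diff[OF velocity_space_sobolev velocity_space_sobolev] assms
    by (intro eventually_all_finite) (simp add: wgrad_def)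
  then show ?thesis
    by eventually_elim (simp add: vec_eq_iff)
qed

lemma strain_diff:
  assumes "v \<in> velocity_space \<Omega>" "w \<in> velocity_space \<Omega>"
  shows "AE x in lebesgue_on \<Omega>. strain \<Omega> (\<lambda>x. v x - w x) x = strain \<Omega> v x - strain \<Omega> w x"
  using wgrad_diff[OF assms]
  by eventually_elim (simp add: strain_def transpose_def vec_eq_iff diff_divide_distrib add_divide_distrib)

lemma wdiv_diff:
  assumes "v \<in> velocity_space \<Omega>" "w \<in> velocity_space \<Omega>"
  shows "AE x in lebesgue_on \<Omega>. wdiv \<Omega> (\<lambda>x. v x - w x) x = wdiv \<Omega> v x - wdiv \<Omega> w x"
  using wgrad_diff[OF assms] by eventually_elim (simp add: wdiv_def sum_subtractf)

lemma l2_norm_strain_diff: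
  assumes "v \<in> velocity_space \<Omega>" "w \<in> velocity_space \<Omega>"
  shows "l2_norm \<Omega> (strain \<Omega> (\<lambda>x. v x - w x)) = l2_norm \<Omega> (\<lambda>x. strain \<Omega> v x - strain \<Omega> w x)"
  by (intro l2_norm_cong_AE strain_diff assms L2_measurable L2_diff strain_in_L2 velocity_space_diff)

text \<open>This is what admits \<open>I h u - u\<^sub>h\<close> as a test function in both
  problems.\<close>

lemma fe_div_free_diff:
  assumes v: "v \<in> fe_div_free \<Omega> T s r" and w: "w \<in> fe_div_free \<Omega> T s r"
  shows "(\<lambda>x. v x - w x) \<in> fe_div_free \<Omega> T s r"
proof -
  have V: "v \<in> velocity_space \<Omega>" "w \<in> velocity_space \<Omega>"
    using v w by (auto simp: fe_div_free_def fe_velocity_def)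
  have pp: "(\<lambda>x. f x - g x) \<in> piecewise_polynomials T s"
    if f: "f \<in> piecewise_polynomials T s" and g: "g \<in> piecewise_polynomials T s" for f g :: "real^'n \<Rightarrow> real"
    unfolding piecewise_polynomials_def mem_Collect_eq
  proof
    fix K assume "K \<in> T"
    then obtain p q where p: "p \<in> polynomials_upto s" "AE x in lebesgue_on K. f x = p x"
      and q: "q \<in> polynomials_upto s" "AE x in lebesgue_on K. g x = q x"
      using f g unfolding piecewise_polynomials_def by blast
    obtain c d where "p = (\<lambda>x. \<Sum>\<alpha> | (\<Sum>i\<in>UNIV. \<alpha> i) \<le> s. c \<alpha> * (\<Prod>i\<in>UNIV. x $ i ^ \<alpha> i))"
      "q = (\<lambda>x. \<Sum>\<alpha> | (\<Sum>i\<in>UNIV. \<alpha> i) \<le> s. d \<alpha> * (\<Prod>i\<in>UNIV. x $ i ^ \<alpha> i))"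
      using p(1) q(1) unfolding polynomials_upto_def by blast
    then have "(\<lambda>x. p x - q x) \<in> polynomials_upto s"
      unfolding polynomials_upto_def
      by (auto intro!: exI[of _ "\<lambda>\<alpha>. c \<alpha> - d \<alpha>"] simp: left_diff_distrib sum_subtractf)
    moreover have "AE x in lebesgue_on K. f x - g x = p x - q x"
      using p(2) q(2) by eventually_elim simp
    ultimately show "\<exists>p\<in>polynomials_upto s. AE x in lebesgue_on K. f x - g x = p x"
      by (intro bexI[of _ "\<lambda>x. p x - q x"])
  qed
  have "l2_inner \<Omega> (wdiv \<Omega> (\<lambda>x. v x - w x)) q = 0" if q: "q \<in> fe_pressure \<Omega> T r" for q
  proof -
    have qL: "q \<in> L2 \<Omega>"
      using q by (simp add: fe_pressure_def L2_zero_mean_def)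
    have "l2_inner \<Omega> (wdiv \<Omega> (\<lambda>x. v x - w x)) q = l2_inner \<Omega> (\<lambda>x. wdiv \<Omega> v x - wdiv \<Omega> w x) q"
      by (intro l2_inner_cong_AE wdiv_diff V L2_measurable L2_diff wdiv_in_L2 velocity_space_diff qL) simp
    also have "\<dots> = l2_inner \<Omega> (wdiv \<Omega> v) q - l2_inner \<Omega> (wdiv \<Omega> w) q"
      by (intro l2_inner_diff_left wdiv_in_L2 V qL)
    also have "\<dots> = 0"
      using v w q by (simp add: fe_div_free_def)
    finally show ?thesis .
  qed
  then show ?thesis
    using v w V pp by (auto simp: fe_div_free_def fe_velocity_def velocity_space_diff)
qed

text \<open>Symmetrizing a matrix keeps its diagonal, so the divergence is the trace of the
  strain.\<close>

lemma l2_norm_wdiv_le: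
  assumes "v \<in> velocity_space \<Omega>"
  shows "l2_norm \<Omega> (wdiv \<Omega> v) \<le> sqrt (real CARD('n)) * l2_norm \<Omega> (strain \<Omega> v)"
proof -
  have "l2_norm \<Omega> (wdiv \<Omega> v) \<le> l2_norm \<Omega> (\<lambda>x. sqrt (real CARD('n)) *\<^sub>R strain \<Omega> v x)"
  proof (rule l2_norm_mono)
    fix x
    have "wdiv \<Omega> v x = (\<Sum>i\<in>UNIV. strain \<Omega> v x $ i $ i)"
      by (simp add: wdiv_def strain_def transpose_def)
    then show "norm (wdiv \<Omega> v x) \<le> norm (sqrt (real CARD('n)) *\<^sub>R strain \<Omega> v x)"
      using trace_le_sqrt_card_norm[of "strain \<Omega> v x"] by simp
  qed (intro wdiv_in_L2 L2_scaleR strain_in_L2 assms)+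
  then show ?thesis by (simp add: l2_norm_scaleR)
qed

end

text \<open>Ensures that the infimum over discrete pressures, taken in the reals, is over a nonempty
  set.\<close>

lemma zero_in_fe_pressure: "(\<lambda>x. 0) \<in> fe_pressure \<Omega> T r"
  unfolding fe_pressure_def L2_zero_mean_def piecewise_polynomials_def polynomials_upto_def
  by (auto simp: L2_iff intro!: bexI[of _ "\<lambda>x. 0"] exI[of _ "\<lambda>\<alpha>. 0"])

section \<open>Error estimates\<close>

text \<open>If \<open>E\<close> exceeded the bound, then \<open>H \<le> E\<close> (by
  \<open>k \<ge> 1\<close>) and \<open>y \<le> E\<close>, so the right-hand side of
  \<open>bound\<close> would be at most \<open>E * (2 c + k H + y) < E^2\<close>.\<close>

lemma le_of_quadratic_bound:
  fixes E H c k y :: real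
  assumes "0 \<le> H" "0 \<le> c" "1 \<le> k" "0 \<le> y"
    and bound: "E\<^sup>2 \<le> k * E * H + c * (E + H) + y\<^sup>2"
  shows "E \<le> 2 * c + k * H + y"
proof (rule ccontr)
  assume "\<not> ?thesis"
  then have gt: "E > 2 * c + k * H + y" by simp
  have "H \<le> k * H"
    using assms mult_right_mono[of 1 k H] by simp
  then have E: "H \<le> E" "y \<le> E" "0 < E"
    using gt assms by linarith+
  have "E * (2 * c + k * H + y) < E * E"
    using gt E(3) by (intro mult_strict_left_mono)
  moreover have "c * H \<le> c * E" "y * y \<le> y * E"
    using E assms by (auto intro: mult_left_mono)
  ultimately show False
    using bound by (simp add: power2_eq_square algebra_simps)
qed

lemma reg_norm_measurable:
  assumes "A \<in> borel_measurable M"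
  shows "(\<lambda>x. reg_norm \<epsilon> (A x)) \<in> borel_measurable M"
  unfolding reg_norm_def
  by (rule measurable_compose[OF _ borel_measurable_continuous_onI[of sqrt]])
    (auto intro!: borel_measurable_add borel_measurable_inner assms continuous_intros)

lemma scaleR_inverse_reg_norm_in_L2:
  assumes "\<epsilon> > 0" "A \<in> borel_measurable (lebesgue_on \<Omega>)" "B \<in> L2 \<Omega>"
  shows "(\<lambda>x. B x /\<^sub>R reg_norm \<epsilon> (A x)) \<in> L2 \<Omega>"
proof (rule L2_dominated[OF assms(3), where C = "inverse \<epsilon>"])
  show "(\<lambda>x. B x /\<^sub>R reg_norm \<epsilon> (A x)) \<in> borel_measurable (lebesgue_on \<Omega>)"
    by (intro borel_measurable_scaleR borel_measurable_inverse reg_norm_measurable assms(2) L2_measurable[OF assms(3)])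
  show "norm (B x /\<^sub>R reg_norm \<epsilon> (A x)) \<le> inverse \<epsilon> * norm (B x)" for x
    using reg_norm_ge[OF assms(1), of "A x"] reg_norm_pos[OF assms(1), of "A x"] assms(1)
    by (auto intro!: mult_right_mono le_imp_inverse_le)
qed

lemma yield_stress_in_L2: "\<epsilon> > 0 \<Longrightarrow> A \<in> L2 \<Omega> \<Longrightarrow> (\<lambda>x. yield_stress \<epsilon> (A x)) \<in> L2 \<Omega>"
  unfolding yield_stress_def by (intro scaleR_inverse_reg_norm_in_L2 L2_measurable)

text \<open>In the application \<open>A\<close>, \<open>B\<close>, \<open>J\<close> are the strains of \<open>u\<close>, \<open>u\<^sub>h\<close>, \<open>I h u\<close>, and
  \<open>c = \<surd>d \<parallel>p - q\<parallel> / (2 \<mu>)\<close>.\<close>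

lemma strain_error_bounds:
  fixes \<Omega> :: "(real^'n) set" and A B J :: "real^'n \<Rightarrow> real^'n^'n"
  defines "E \<equiv> l2_norm \<Omega> (\<lambda>x. A x - B x)"
    and "H \<equiv> l2_norm \<Omega> (\<lambda>x. A x - J x)"
  assumes L: "A \<in> L2 \<Omega>" "B \<in> L2 \<Omega>" "J \<in> L2 \<Omega>"
    and pos: "\<mu> > 0" "\<tau> \<ge> 0" "\<epsilon> > 0" "c \<ge> 0"
    and orth: "2 * \<mu> * l2_inner \<Omega> (\<lambda>x. A x - B x) (\<lambda>x. J x - B x) +
      \<tau> * l2_inner \<Omega> (\<lambda>x. yield_stress \<epsilon> (A x) - yield_stress \<epsilon> (B x)) (\<lambda>x. J x - B x)
      \<le> 2 * \<mu> * c * l2_norm \<Omega> (\<lambda>x. J x - B x)"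
  shows "E \<le> 2 * c + (1 + \<tau> * inverse \<epsilon> / (2 * \<mu>)) * H"
    and "l2_norm \<Omega> (\<lambda>x. (J x - B x) /\<^sub>R reg_norm \<epsilon> (A x)) \<le> 1 \<Longrightarrow>
      E \<le> 2 * c + H + sqrt (\<tau> * H / \<mu>)"
proof -
  let ?F = "\<lambda>A x. yield_stress \<epsilon> (A x)"
  let ?S = "l2_inner \<Omega> (\<lambda>x. ?F A x - ?F B x) (\<lambda>x. J x - B x)"
  have nn: "0 \<le> E" "0 \<le> H"
    by (simp_all add: E_def H_def)
  have Y: "?F A \<in> L2 \<Omega>" "?F B \<in> L2 \<Omega>" "?F J \<in> L2 \<Omega>"
    by (intro yield_stress_in_L2 pos L)+
  have AB: "(\<lambda>x. A x - B x) \<in> L2 \<Omega>" and AJ: "(\<lambda>x. A x - J x) \<in> L2 \<Omega>"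
    and JB: "(\<lambda>x. J x - B x) \<in> L2 \<Omega>"
    by (intro L2_diff L)+
  have FAB: "(\<lambda>x. ?F A x - ?F B x) \<in> L2 \<Omega>" and FAJ: "(\<lambda>x. ?F A x - ?F J x) \<in> L2 \<Omega>"
    and FJB: "(\<lambda>x. ?F J x - ?F B x) \<in> L2 \<Omega>"
    by (intro L2_diff Y)+
  \<comment> \<open>The splitting \<open>\<phi> = e - \<eta>\<close> at the level of
    strains.\<close>
  have JB_split: "(\<lambda>x. J x - B x) = (\<lambda>x. (A x - B x) - (A x - J x))"
    by auto
  have monotone: "0 \<le> l2_inner \<Omega> (\<lambda>x. yield_stress \<epsilon> (X x) - yield_stress \<epsilon> (Z x)) (\<lambda>x. X x - Z x)" for X Z
    unfolding l2_inner_def by (intro Bochner_Integration.integral_nonneg yield_stress_monotone pos)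
  have JB_le: "l2_norm \<Omega> (\<lambda>x. J x - B x) \<le> E + H"
    unfolding JB_split E_def H_def by (rule l2_norm_triangle_diff[OF AB AJ])
  have "l2_inner \<Omega> (\<lambda>x. A x - B x) (\<lambda>x. J x - B x) = E\<^sup>2 - l2_inner \<Omega> (\<lambda>x. A x - B x) (\<lambda>x. A x - J x)"
    unfolding JB_split l2_inner_diff_right[OF AB AJ AB] by (simp add: E_def l2_norm_power2)
  moreover have "l2_inner \<Omega> (\<lambda>x. A x - B x) (\<lambda>x. A x - J x) \<le> E * H"
    using l2_cauchy_schwarz[OF AB AJ] by (simp add: E_def H_def)
  ultimately have "E\<^sup>2 - E * H \<le> l2_inner \<Omega> (\<lambda>x. A x - B x) (\<lambda>x. J x - B x)"
    by linarith
  then have "2 * \<mu> * (E\<^sup>2 - E * H) \<le> 2 * \<mu> * l2_inner \<Omega> (\<lambda>x. A x - B x) (\<lambda>x. J x - B x)"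
    using pos by (intro mult_left_mono) auto
  moreover have "2 * \<mu> * c * l2_norm \<Omega> (\<lambda>x. J x - B x) \<le> 2 * \<mu> * c * (E + H)"
    using JB_le pos by (intro mult_left_mono) auto
  ultimately have "2 * \<mu> * (E\<^sup>2 - E * H) \<le> 2 * \<mu> * c * (E + H) + \<tau> * (- ?S)"
    using orth by simp
  \<comment> \<open>\<open>R\<close> is any upper bound for the nonlinear term \<open>- ?S\<close>;
    the two estimates differ only in the \<open>R\<close> they supply.\<close>
  then have key: "2 * \<mu> * (E\<^sup>2 - E * H - c * (E + H)) \<le> \<tau> * R" if "- ?S \<le> R" for R
    using mult_left_mono[OF that pos(2)] by (simp add: algebra_simps)
  have key: "E\<^sup>2 \<le> E * H + c * (E + H) + \<tau> * R / (2 * \<mu>)" if "- ?S \<le> R" for R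
    using key[OF that] pos(1) by (simp add: field_simps)

  have "l2_norm \<Omega> (\<lambda>x. ?F A x - ?F B x) \<le> l2_norm \<Omega> (\<lambda>x. inverse \<epsilon> *\<^sub>R (A x - B x))"
    using yield_stress_lipschitz[OF pos(3)] pos(3) by (intro l2_norm_mono FAB L2_scaleR AB) simp
  then have lip: "l2_norm \<Omega> (\<lambda>x. ?F A x - ?F B x) \<le> inverse \<epsilon> * E"
    using pos(3) by (simp add: l2_norm_scaleR E_def)
  \<comment> \<open>First choice of \<open>R\<close>: the part tested with \<open>A - B\<close> has
    a good sign by monotonicity, and the Lipschitz bound controls the rest by
    \<open>E * H / \<epsilon>\<close>.\<close>
  have "- ?S = l2_inner \<Omega> (\<lambda>x. ?F A x - ?F B x) (\<lambda>x. A x - J x) - l2_inner \<Omega> (\<lambda>x. ?F A x - ?F B x) (\<lambda>x. A x - B x)"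
    unfolding JB_split l2_inner_diff_right[OF AB AJ FAB] by simp
  also have "\<dots> \<le> l2_norm \<Omega> (\<lambda>x. ?F A x - ?F B x) * H"
    using l2_cauchy_schwarz[OF FAB AJ] monotone[of A B] by (simp add: H_def)
  also have "\<dots> \<le> inverse \<epsilon> * E * H"
    using lip nn by (intro mult_right_mono)
  finally have "E\<^sup>2 \<le> (1 + \<tau> * inverse \<epsilon> / (2 * \<mu>)) * E * H + c * (E + H) + 0\<^sup>2"
    using key by (fastforce simp: algebra_simps)
  from le_of_quadratic_bound[OF nn(2) pos(4) _ order_refl this]
  show "E \<le> 2 * c + (1 + \<tau> * inverse \<epsilon> / (2 * \<mu>)) * H"
    using pos by simp

  assume small: "l2_norm \<Omega> (\<lambda>x. (J x - B x) /\<^sub>R reg_norm \<epsilon> (A x)) \<le> 1"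
  \<comment> \<open>Scalar fields chosen so that Cauchy-Schwarz places the weight
    \<open>1 / reg_norm \<epsilon> (A x)\<close> on \<open>J - B\<close>, the factor assumed
    small.\<close>
  let ?a = "\<lambda>x. 2 *\<^sub>R norm (A x - J x)" and ?b = "\<lambda>x. norm ((J x - B x) /\<^sub>R reg_norm \<epsilon> (A x))"
  have W: "(\<lambda>x. (J x - B x) /\<^sub>R reg_norm \<epsilon> (A x)) \<in> L2 \<Omega>"
    by (intro scaleR_inverse_reg_norm_in_L2 pos JB L2_measurable[OF L(1)])
  have norm_L2: "(\<lambda>x. norm (X x)) \<in> L2 \<Omega>" if "X \<in> L2 \<Omega>" for X :: "real^'n \<Rightarrow> real^'n^'n"
    using that by (auto simp: L2_iff)
  have ab: "?a \<in> L2 \<Omega>" "?b \<in> L2 \<Omega>"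
    by (intro L2_scaleR norm_L2 AJ W)+
  have "- l2_inner \<Omega> (\<lambda>x. ?F A x - ?F J x) (\<lambda>x. J x - B x) = l2_inner \<Omega> (\<lambda>x. - (?F A x - ?F J x)) (\<lambda>x. J x - B x)"
    by (simp add: l2_inner_def flip: integral_minus inner_minus_left)
  also have "\<dots> \<le> l2_inner \<Omega> ?a ?b"
  proof (rule l2_inner_mono)
    show "(\<lambda>x. - (?F A x - ?F J x)) \<in> L2 \<Omega>"
      using L2_scaleR[OF FAJ, of "-1"] by simp
    fix x
    have "- (?F A x - ?F J x) \<bullet> (J x - B x) \<le> norm (?F A x - ?F J x) * norm (J x - B x)"
      using norm_cauchy_schwarz[of "- (?F A x - ?F J x)" "J x - B x"] by (simp only: norm_minus_cancel)
    also have "\<dots> \<le> 2 * norm (A x - J x) / reg_norm \<epsilon> (A x) * norm (J x - B x)"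
      by (intro mult_right_mono yield_stress_local_lipschitz pos) simp
    also have "\<dots> = ?a x \<bullet> ?b x"
      using reg_norm_pos[OF pos(3), of "A x"] by (simp add: divide_inverse)
    finally show "- (?F A x - ?F J x) \<bullet> (J x - B x) \<le> ?a x \<bullet> ?b x" .
  qed (fact JB ab)+
  also have "\<dots> \<le> l2_norm \<Omega> ?a * l2_norm \<Omega> ?b"
    using l2_cauchy_schwarz[OF ab] by simp
  also have "\<dots> = 2 * H * l2_norm \<Omega> (\<lambda>x. (J x - B x) /\<^sub>R reg_norm \<epsilon> (A x))"
    unfolding l2_norm_scaleR by (simp add: l2_norm_def H_def)
  also have "\<dots> \<le> 2 * H"
    using small nn mult_left_mono[OF small, of "2 * H"] by simp
  finally have FAJ_le: "- l2_inner \<Omega> (\<lambda>x. ?F A x - ?F J x) (\<lambda>x. J x - B x) \<le> 2 * H" .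
  \<comment> \<open>Second choice of \<open>R\<close>: inserting the stress of \<open>J\<close>
    leaves a difference of stresses at \<open>J\<close> and \<open>B\<close> tested with
    \<open>J - B\<close>, nonnegative by monotonicity.\<close>
  have "?S = l2_inner \<Omega> (\<lambda>x. ?F A x - ?F J x) (\<lambda>x. J x - B x) + l2_inner \<Omega> (\<lambda>x. ?F J x - ?F B x) (\<lambda>x. J x - B x)"
    using l2_inner_add_left[OF FAJ FJB JB] by simp
  then have "- ?S \<le> 2 * H"
    using FAJ_le monotone[of J B] by linarith
  \<comment> \<open>With \<open>R = 2 * H\<close> the nonlinear term becomes
    \<open>\<tau> * H / \<mu>\<close>, entered as \<open>y^2\<close>, and
    \<open>k = 1\<close>.\<close>
  from key[OF this] have "E\<^sup>2 \<le> 1 * E * H + c * (E + H) + (sqrt (\<tau> * H / \<mu>))\<^sup>2"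
    using pos nn by simp
  from le_of_quadratic_bound[OF nn(2) pos(4) order_refl _ this]
  show "E \<le> 2 * c + H + sqrt (\<tau> * H / \<mu>)"
    using pos nn by simp
qed

section \<open>Comparison of the continuous and the discrete problem\<close>

lemma bingham_form_eq:
  "bingham_form \<Omega> \<mu> \<tau> \<epsilon> u v =
     2 * \<mu> * l2_inner \<Omega> (strain \<Omega> u) (strain \<Omega> v) +
     \<tau> * l2_inner \<Omega> (\<lambda>x. yield_stress \<epsilon> (strain \<Omega> u x)) (strain \<Omega> v)"
  by (simp add: bingham_form_def yield_stress_def)

text \<open>A discretely divergence-free \<open>v\<close> is admissible in both problems, so
  \<open>f v\<close> cancels. The continuous pressure term remains because
  \<open>wdiv \<Omega> v\<close> is orthogonal only to discrete pressures; for the same reason any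
  such \<open>q\<close> may be subtracted from \<open>p\<close>.\<close>

lemma bingham_error_identity:
  fixes u :: "real^'n \<Rightarrow> real^'n"
  assumes \<Omega>: "open \<Omega>" "bounded \<Omega>" and \<epsilon>: "\<epsilon> > 0"
    and sol: "bingham_solution \<Omega> \<mu> \<tau> \<epsilon> f u p"
    and dsol: "discrete_bingham_solution \<Omega> T s r \<mu> \<tau> \<epsilon> f u\<^sub>h"
    and v: "v \<in> fe_div_free \<Omega> T s r" and q: "q \<in> fe_pressure \<Omega> T r"
  shows "2 * \<mu> * l2_inner \<Omega> (\<lambda>x. strain \<Omega> u x - strain \<Omega> u\<^sub>h x) (strain \<Omega> v) +
    \<tau> * l2_inner \<Omega> (\<lambda>x. yield_stress \<epsilon> (strain \<Omega> u x) - yield_stress \<epsilon> (strain \<Omega> u\<^sub>h x)) (strain \<Omega> v) =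
    l2_inner \<Omega> (\<lambda>x. p x - q x) (wdiv \<Omega> v)"
proof -
  have V: "u \<in> velocity_space \<Omega>" "u\<^sub>h \<in> velocity_space \<Omega>" "v \<in> velocity_space \<Omega>"
    using sol dsol v by (auto simp: bingham_solution_def discrete_bingham_solution_def fe_div_free_def fe_velocity_def)
  have Q: "p \<in> L2 \<Omega>" "p \<in> L2_zero_mean \<Omega>" "q \<in> L2 \<Omega>"
    using sol q by (auto simp: bingham_solution_def fe_pressure_def L2_zero_mean_def)
  have "bingham_form \<Omega> \<mu> \<tau> \<epsilon> u v - l2_inner \<Omega> p (wdiv \<Omega> v) = f v"
    using sol V(3) Q(2) unfolding bingham_solution_def by blast
  moreover have "bingham_form \<Omega> \<mu> \<tau> \<epsilon> u\<^sub>h v = f v"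
    using dsol v by (simp add: discrete_bingham_solution_def)
  moreover have "l2_inner \<Omega> q (wdiv \<Omega> v) = 0"
    using v q by (simp add: fe_div_free_def l2_inner_commute[of \<Omega> q])
  moreover note S = strain_in_L2[OF \<Omega> V(1)] strain_in_L2[OF \<Omega> V(2)] strain_in_L2[OF \<Omega> V(3)]
  moreover note Y = yield_stress_in_L2[OF \<epsilon> S(1)] yield_stress_in_L2[OF \<epsilon> S(2)]
  ultimately show ?thesis
    unfolding l2_inner_diff_left[OF S] l2_inner_diff_left[OF Y S(3)]
      l2_inner_diff_left[OF Q(1,3) wdiv_in_L2[OF \<Omega> V(3)]] bingham_form_eq
    by (simp add: algebra_simps)
qed

theorem theorem5p1:
  fixes \<Omega> :: "(real^'n) set"
    and H :: "real set"
    and \<T> :: "real \<Rightarrow> (real^'n) set set"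
    and s r :: nat
    and I :: "real \<Rightarrow> (real^'n \<Rightarrow> real^'n) \<Rightarrow> (real^'n \<Rightarrow> real^'n)"
    and \<mu> \<tau>\<^sub>s \<epsilon> h :: real
    and f :: "(real^'n \<Rightarrow> real^'n) \<Rightarrow> real"
    and u u\<^sub>h :: "real^'n \<Rightarrow> real^'n"
    and p :: "real^'n \<Rightarrow> real"
  assumes "CARD('n) \<in> {2, 3}"
    and "admissible_domain \<Omega>"
    and "regular_mesh_family \<Omega> H \<T>"
    and "discrete_inf_sup \<Omega> H \<T> s r"
    and "interpolation_operators \<Omega> H \<T> s r I"
    and "\<mu> > 0" and "\<tau>\<^sub>s \<ge> 0" and "\<epsilon> > 0"
    and "f \<in> dual_velocity_space \<Omega>"
    and "bingham_solution \<Omega> \<mu> \<tau>\<^sub>s \<epsilon> f u p"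
    and "h \<in> H"
    and "discrete_bingham_solution \<Omega> (\<T> h) s r \<mu> \<tau>\<^sub>s \<epsilon> f u\<^sub>h"
    and "I h u \<in> fe_div_free \<Omega> (\<T> h) s r"
  shows "l2_norm \<Omega> (strain \<Omega> (\<lambda>x. u x - u\<^sub>h x)) \<le>
           inverse \<mu> * sqrt (real CARD('n)) *
             (INF q\<in>fe_pressure \<Omega> (\<T> h) r. l2_norm \<Omega> (\<lambda>x. p x - q x)) +
           sqrt (3 + 3 * \<tau>\<^sub>s\<^sup>2 * inverse (\<epsilon>\<^sup>2) * inverse (\<mu>\<^sup>2)) *
             l2_norm \<Omega> (strain \<Omega> (\<lambda>x. u x - I h u x)) \<and>
         (l2_norm \<Omega> (\<lambda>x. strain \<Omega> (\<lambda>y. I h u y - u\<^sub>h y) x /\<^sub>R reg_norm \<epsilon> (strain \<Omega> u x)) \<le> 1 \<longrightarrow>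
          l2_norm \<Omega> (strain \<Omega> (\<lambda>x. u x - u\<^sub>h x)) \<le>
            inverse \<mu> * sqrt (real CARD('n)) *
              (INF q\<in>fe_pressure \<Omega> (\<T> h) r. l2_norm \<Omega> (\<lambda>x. p x - q x)) +
            sqrt 2 * l2_norm \<Omega> (strain \<Omega> (\<lambda>x. u x - I h u x)) +
            sqrt (2 * inverse \<mu> * \<tau>\<^sub>s) *
              sqrt (l2_norm \<Omega> (strain \<Omega> (\<lambda>x. u x - I h u x))))"
proof -
  have \<Omega>: "open \<Omega>" "bounded \<Omega>"
    using assms(2) by (auto simp: admissible_domain_def)
  note \<mu> = assms(6) and \<tau> = assms(7) and \<epsilon> = assms(8) and sol = assms(10) and dsol = assms(12) and I = assms(13)
  let ?A = "strain \<Omega> u" and ?B = "strain \<Omega> u\<^sub>h" and ?J = "strain \<Omega> (I h u)"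
  let ?\<phi> = "\<lambda>x. I h u x - u\<^sub>h x" and ?d = "sqrt (real CARD('n))"
  let ?E = "l2_norm \<Omega> (\<lambda>x. ?A x - ?B x)" and ?H = "l2_norm \<Omega> (\<lambda>x. ?A x - ?J x)"
  let ?P = "INF q\<in>fe_pressure \<Omega> (\<T> h) r. l2_norm \<Omega> (\<lambda>x. p x - q x)"
  have u\<^sub>h: "u\<^sub>h \<in> fe_div_free \<Omega> (\<T> h) s r"
    using dsol by (simp add: discrete_bingham_solution_def)
  have V: "u \<in> velocity_space \<Omega>" "u\<^sub>h \<in> velocity_space \<Omega>" "I h u \<in> velocity_space \<Omega>"
    using sol u\<^sub>h I by (auto simp: bingham_solution_def fe_div_free_def fe_velocity_def)
  have \<phi>: "?\<phi> \<in> fe_div_free \<Omega> (\<T> h) s r" "?\<phi> \<in> velocity_space \<Omega>"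
    using fe_div_free_diff[OF \<Omega> I u\<^sub>h] velocity_space_diff[OF \<Omega> V(3,2)] by auto
  note S = strain_in_L2[OF \<Omega> V(1)] strain_in_L2[OF \<Omega> V(2)] strain_in_L2[OF \<Omega> V(3)]
  note S\<phi> = strain_in_L2[OF \<Omega> \<phi>(2)] and JB = L2_diff[OF S(3,2)]
  note AB = L2_diff[OF S(1,2)] and Y = L2_diff[OF yield_stress_in_L2[OF \<epsilon> S(1)] yield_stress_in_L2[OF \<epsilon> S(2)]]
  note strain_\<phi> = strain_diff[OF \<Omega> V(3,2)]

  have bounds: "?E \<le> inverse \<mu> * ?d * l2_norm \<Omega> (\<lambda>x. p x - q x) + (1 + \<tau>\<^sub>s * inverse \<epsilon> / (2 * \<mu>)) * ?H"
    "l2_norm \<Omega> (\<lambda>x. (?J x - ?B x) /\<^sub>R reg_norm \<epsilon> (?A x)) \<le> 1 \<Longrightarrow>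
      ?E \<le> inverse \<mu> * ?d * l2_norm \<Omega> (\<lambda>x. p x - q x) + ?H + sqrt (\<tau>\<^sub>s * ?H / \<mu>)"
    if q: "q \<in> fe_pressure \<Omega> (\<T> h) r" for q
  proof -
    let ?q = "l2_norm \<Omega> (\<lambda>x. p x - q x)"
    \<comment> \<open>Chosen so that \<open>2 * \<mu> * c\<close> is the constant produced by
      Cauchy-Schwarz and the divergence bound, while \<open>2 * c\<close> is the pressure term of
      the theorem.\<close>
    define c where "c = ?d * ?q / (2 * \<mu>)"
    have c: "c \<ge> 0" "2 * c = inverse \<mu> * ?d * ?q" "2 * \<mu> * c = ?d * ?q"
      using \<mu> by (simp_all add: c_def field_simps)
    have pq: "(\<lambda>x. p x - q x) \<in> L2 \<Omega>"
      using sol q by (intro L2_diff) (auto simp: bingham_solution_def fe_pressure_def L2_zero_mean_def)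
    have "l2_inner \<Omega> (\<lambda>x. p x - q x) (wdiv \<Omega> ?\<phi>) \<le> ?q * l2_norm \<Omega> (wdiv \<Omega> ?\<phi>)"
      using l2_cauchy_schwarz[OF pq wdiv_in_L2[OF \<Omega> \<phi>(2)]] by simp
    also have "\<dots> \<le> ?q * (?d * l2_norm \<Omega> (strain \<Omega> ?\<phi>))"
      by (intro mult_left_mono l2_norm_wdiv_le \<Omega> \<phi>) simp
    also have "l2_norm \<Omega> (strain \<Omega> ?\<phi>) = l2_norm \<Omega> (\<lambda>x. ?J x - ?B x)"
      by (rule l2_norm_strain_diff[OF \<Omega> V(3,2)])
    finally have le: "l2_inner \<Omega> (\<lambda>x. p x - q x) (wdiv \<Omega> ?\<phi>) \<le> 2 * \<mu> * c * l2_norm \<Omega> (\<lambda>x. ?J x - ?B x)"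
      unfolding c(3) by (simp only: mult_ac)
    have to_JB: "l2_inner \<Omega> X (strain \<Omega> ?\<phi>) = l2_inner \<Omega> X (\<lambda>x. ?J x - ?B x)" if "X \<in> L2 \<Omega>" for X
      by (rule l2_inner_cong_AE[OF L2_measurable[OF that] L2_measurable[OF that] L2_measurable[OF S\<phi>]
            L2_measurable[OF JB] _ strain_\<phi>]) simp
    note orth = le[folded bingham_error_identity[OF \<Omega> \<epsilon> sol dsol \<phi>(1) q], unfolded to_JB[OF AB] to_JB[OF Y]]
    show "?E \<le> inverse \<mu> * ?d * ?q + (1 + \<tau>\<^sub>s * inverse \<epsilon> / (2 * \<mu>)) * ?H"
      using strain_error_bounds(1)[OF S \<mu> \<tau> \<epsilon> c(1) orth] by (simp only: c(2))
    show "?E \<le> inverse \<mu> * ?d * ?q + ?H + sqrt (\<tau>\<^sub>s * ?H / \<mu>)"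
      if "l2_norm \<Omega> (\<lambda>x. (?J x - ?B x) /\<^sub>R reg_norm \<epsilon> (?A x)) \<le> 1"
      using strain_error_bounds(2)[OF S \<mu> \<tau> \<epsilon> c(1) orth that] by (simp only: c(2))
  qed
  have INF: "?E \<le> inverse \<mu> * ?d * ?P + R"
    if "\<And>q. q \<in> fe_pressure \<Omega> (\<T> h) r \<Longrightarrow> ?E \<le> inverse \<mu> * ?d * l2_norm \<Omega> (\<lambda>x. p x - q x) + R" for R
  proof -
    have d: "inverse \<mu> * ?d > 0"
      using \<mu> by simp
    \<comment> \<open>Solving for the pressure norm gives a lower bound valid for every
      \<open>q\<close>, hence for the infimum.\<close>
    have "(?E - R) / (inverse \<mu> * ?d) \<le> ?P"
      by (rule cINF_greatest) (use zero_in_fe_pressure that d in \<open>fastforce simp: pos_divide_le_eq mult.commute\<close>)+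
    then show ?thesis
      using d by (simp add: pos_divide_le_eq mult.commute)
  qed
  define x where "x = \<tau>\<^sub>s * inverse \<epsilon> / \<mu>"
  have "1 + x / 2 \<le> sqrt (3 + 3 * x\<^sup>2)"
  proof (rule real_le_rsqrt)
    \<comment> \<open>The right-hand side is \<open>3 + 3 x^2 - (1 + x/2)^2\<close> written as a sum
      of nonnegative terms.\<close>
    have "0 \<le> 2 * (x - 1/4)\<^sup>2 + 3/4 * x\<^sup>2 + 15/8" by simp
    then show "(1 + x / 2)\<^sup>2 \<le> 3 + 3 * x\<^sup>2"
      by (simp add: power2_eq_square field_simps)
  qed
  moreover have x2: "3 * x\<^sup>2 = 3 * \<tau>\<^sub>s\<^sup>2 * inverse (\<epsilon>\<^sup>2) * inverse (\<mu>\<^sup>2)"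
    by (simp add: x_def power_mult_distrib power_divide power_inverse divide_inverse)
  moreover have xh: "\<tau>\<^sub>s * inverse \<epsilon> / (2 * \<mu>) = x / 2"
    by (simp add: x_def)
  ultimately have k: "1 + \<tau>\<^sub>s * inverse \<epsilon> / (2 * \<mu>) \<le> sqrt (3 + 3 * \<tau>\<^sub>s\<^sup>2 * inverse (\<epsilon>\<^sup>2) * inverse (\<mu>\<^sup>2))"
    by (simp only: x2 xh)
  have first: "?E \<le> inverse \<mu> * ?d * ?P + sqrt (3 + 3 * \<tau>\<^sub>s\<^sup>2 * inverse (\<epsilon>\<^sup>2) * inverse (\<mu>\<^sup>2)) * ?H"
    using INF[OF bounds(1)] mult_right_mono[OF k l2_norm_nonneg[of \<Omega> "\<lambda>x. ?A x - ?J x"]] by linarith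
  have second: "?E \<le> inverse \<mu> * ?d * ?P + sqrt 2 * ?H + sqrt (2 * inverse \<mu> * \<tau>\<^sub>s) * sqrt ?H"
    if "l2_norm \<Omega> (\<lambda>x. strain \<Omega> ?\<phi> x /\<^sub>R reg_norm \<epsilon> (?A x)) \<le> 1"
  proof -
    have "l2_norm \<Omega> (\<lambda>x. strain \<Omega> ?\<phi> x /\<^sub>R reg_norm \<epsilon> (?A x)) =
        l2_norm \<Omega> (\<lambda>x. (?J x - ?B x) /\<^sub>R reg_norm \<epsilon> (?A x))"
      by (rule l2_norm_cong_AE[OF L2_measurable[OF scaleR_inverse_reg_norm_in_L2[OF \<epsilon> L2_measurable[OF S(1)] S\<phi>]]
            L2_measurable[OF scaleR_inverse_reg_norm_in_L2[OF \<epsilon> L2_measurable[OF S(1)] JB]]])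
        (use strain_\<phi> in eventually_elim, simp)
    with that have small: "l2_norm \<Omega> (\<lambda>x. (?J x - ?B x) /\<^sub>R reg_norm \<epsilon> (?A x)) \<le> 1"
      by simp
    have "?E \<le> inverse \<mu> * ?d * ?P + (?H + sqrt (\<tau>\<^sub>s * ?H / \<mu>))"
      using bounds(2)[OF _ small] by (intro INF) (simp add: add.assoc)
    \<comment> \<open>The estimate obtained has constants 1 and
      \<open>\<tau>\<^sub>s / \<mu>\<close>; they are enlarged to the stated \<open>sqrt 2\<close>
      and \<open>2 \<tau>\<^sub>s / \<mu>\<close>.\<close>
    moreover have "?H \<le> sqrt 2 * ?H"
      using mult_right_mono[of 1 "sqrt 2" ?H] by simp
    moreover have "sqrt (\<tau>\<^sub>s * ?H / \<mu>) \<le> sqrt (2 * inverse \<mu> * \<tau>\<^sub>s) * sqrt ?H"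
      unfolding real_sqrt_mult[symmetric] using \<mu> \<tau>
      by (intro real_sqrt_le_mono) (simp add: divide_inverse mult_ac)
    ultimately show ?thesis by linarith
  qed
  show ?thesis
    unfolding l2_norm_strain_diff[OF \<Omega> V(1,2)] l2_norm_strain_diff[OF \<Omega> V(1,3)]
    using first second by blast
qed

end
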